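(* Let $d$ be prime, $n\ge1$, $G$ positive and invertible over $\mathbb Z_d$, and $\rho,\sigma$ $n$-qudit states. Then $\rho\boxtimes\sigma$ has minimal entropy (i.e. is a pure state, $H(\rho\boxtimes\sigma)=0$) if and only if $\rho$ and $\sigma$ are pure stabilizer states whose stabilizer groups $S_1$ (of $\rho$) and $S_2$ (of $\sigma$) satisfy $$S_1=\{w(-g_{10}^{-1}g_{11}\vec p,\ g_{01}^{-1}g_{00}\vec q):\ w(\vec p,\vec q)\in S_2\}$$ (as groups of Weyl operators up to phases).
   Context: Fix a prime $d$; $\chi(k)=e^{2\pi ik/d}$, $X|k\rangle=|k+1\rangle$, $Z|k\rangle=\chi(k)|k\rangle$ on $\mathbb C^d$; Weyl operators $w(p,q)=\chi(-2^{-1}pq)Z^pX^q$ (odd $d$), $w(p,q)=i^{-pq}Z^pX^q$ ($d=2$), $w(\vec p,\vec q)=\bigotimes_kw(p_k,q_k)$. A pure stabilizer state is (the projector onto) a common eigenvector of an abelian group of $d^n$ Weyl operators (up to phases), called its stabilizer group. $G=\begin{pmatrix}g_{00}&g_{01}\\ g_{10}&g_{11}\end{pmatrix}$ over $\mathbb Z_d$ with $\det G\not\equiv0$, $N=(\det G)^{-1}$; positive means all entries nonzero mod $d$. Key unitary $U|\vec i\rangle|\vec j\rangle=|Ng_{11}\vec i-Ng_{10}\vec j\rangle|-Ng_{01}\vec i+Ng_{00}\vec j\rangle$; convolution $\rho\boxtimes\sigma=\mathrm{Tr}_B[U(\rho\otimes\sigma)U^\dagger]$. $H$ is von Neumann entropy.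 *)

theory Defs
  imports "Jordan_Normal_Form.Jordan_Normal_Form" "HOL-Number_Theory.Modular_Inverse"
    "HOL-Computational_Algebra.Fundamental_Theorem_Algebra"
begin

text \<open>n-qudit Hilbert space (C^d)^{tensor n} with computational basis indexed by
  i < d^n, the k-th qudit of basis index i being the digit (i div d^k) mod d.
  Weyl labels (p,q) are pairs of functions nat => int with components in {0..<d}
  for k < n and 0 for k >= n. The matrix G is given by four integer entries.\<close>

definition chi :: "nat \<Rightarrow> int \<Rightarrow> complex" where
  "chi d k = exp (2 * of_real pi * \<i> * of_int k / of_nat d)"

definition dig :: "nat \<Rightarrow> nat \<Rightarrow> nat \<Rightarrow> int" where
  "dig d k i = int ((i div d ^ k) mod d)"

definition enc :: "nat \<Rightarrow> nat \<Rightarrow> (nat \<Rightarrow> int) \<Rightarrow> nat" where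
  "enc d n f = nat (\<Sum>k<n. (f k mod int d) * int d ^ k)"

definition weyl_phase :: "nat \<Rightarrow> int \<Rightarrow> int \<Rightarrow> complex" where
  "weyl_phase d p q = (if d = 2 then \<i> powi (- (p * q))
      else chi d (- (modular_inverse (int d) 2) * p * q))"

text \<open>matrix entry <r| w(p,q) |c> of the single-qudit Weyl operator
  w(p,q) = phase * Z^p X^q, where Z^p X^q |c> = chi(p(c+q)) |c+q>\<close>
definition weyl1 :: "nat \<Rightarrow> int \<Rightarrow> int \<Rightarrow> int \<Rightarrow> int \<Rightarrow> complex" where
  "weyl1 d p q r c = (if r = (c + q) mod int d then weyl_phase d p q * chi d (p * (c + q)) else 0)"

definition weyl :: "nat \<Rightarrow> nat \<Rightarrow> (nat \<Rightarrow> int) \<times> (nat \<Rightarrow> int) \<Rightarrow> complex mat" where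
  "weyl d n pq = mat (d ^ n) (d ^ n)
     (\<lambda>(r, c). \<Prod>k<n. weyl1 d (fst pq k) (snd pq k) (dig d k r) (dig d k c))"

definition labels :: "nat \<Rightarrow> nat \<Rightarrow> ((nat \<Rightarrow> int) \<times> (nat \<Rightarrow> int)) set" where
  "labels d n = {(p, q). \<forall>k. (k < n \<longrightarrow> 0 \<le> p k \<and> p k < int d \<and> 0 \<le> q k \<and> q k < int d)
                            \<and> (n \<le> k \<longrightarrow> p k = 0 \<and> q k = 0)}"

definition label_add :: "nat \<Rightarrow> (nat \<Rightarrow> int) \<times> (nat \<Rightarrow> int) \<Rightarrow> (nat \<Rightarrow> int) \<times> (nat \<Rightarrow> int)
    \<Rightarrow> (nat \<Rightarrow> int) \<times> (nat \<Rightarrow> int)" where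
  "label_add d a b = ((\<lambda>k. (fst a k + fst b k) mod int d), (\<lambda>k. (snd a k + snd b k) mod int d))"

definition proj_of :: "nat \<Rightarrow> complex vec \<Rightarrow> complex mat" where
  "proj_of D \<psi> = mat D D (\<lambda>(i, j). \<psi> $ i * cnj (\<psi> $ j))"

text \<open>rho is a pure stabilizer state with stabilizer group S (Weyl labels, i.e. Weyl
  operators up to phases): S is an abelian group of d^n Weyl operators (up to phase)
  and rho = |psi><psi| with psi a normalized common eigenvector of all w in S.\<close>
definition is_pure_stabilizer_state ::
  "nat \<Rightarrow> nat \<Rightarrow> complex mat \<Rightarrow> ((nat \<Rightarrow> int) \<times> (nat \<Rightarrow> int)) set \<Rightarrow> bool" where
  "is_pure_stabilizer_state d n \<rho> S \<longleftrightarrow>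
     S \<subseteq> labels d n \<and> card S = d ^ n \<and> ((\<lambda>k. 0), (\<lambda>k. 0)) \<in> S
     \<and> (\<forall>a\<in>S. \<forall>b\<in>S. label_add d a b \<in> S)
     \<and> (\<forall>a\<in>S. \<forall>b\<in>S. weyl d n a * weyl d n b = weyl d n b * weyl d n a)
     \<and> (\<exists>\<psi>. \<psi> \<in> carrier_vec (d ^ n) \<and> (\<Sum>i<d ^ n. (cmod (\<psi> $ i))\<^sup>2) = 1
            \<and> \<rho> = proj_of (d ^ n) \<psi>
            \<and> (\<forall>a\<in>S. \<exists>c::complex. weyl d n a *\<^sub>v \<psi> = c \<cdot>\<^sub>v \<psi>))"

definition ctrace :: "complex mat \<Rightarrow> complex" where
  "ctrace A = (\<Sum>i<dim_row A. A $$ (i, i))"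

definition adj :: "complex mat \<Rightarrow> complex mat" where
  "adj A = mat (dim_col A) (dim_row A) (\<lambda>(i, j). cnj (A $$ (j, i)))"

definition density_matrix :: "nat \<Rightarrow> complex mat \<Rightarrow> bool" where
  "density_matrix D \<rho> \<longleftrightarrow> \<rho> \<in> carrier_mat D D \<and> adj \<rho> = \<rho>
     \<and> (\<forall>v \<in> carrier_vec D. Re (\<Sum>i<D. \<Sum>j<D. cnj (v $ i) * \<rho> $$ (i, j) * v $ j) \<ge> 0)
     \<and> ctrace \<rho> = 1"

text \<open>Kronecker product, index of |a>|b> is a * dim(B) + b\<close>
definition kron :: "complex mat \<Rightarrow> complex mat \<Rightarrow> complex mat" where
  "kron A B = mat (dim_row A * dim_row B) (dim_col A * dim_col B)
     (\<lambda>(i, j). A $$ (i div dim_row B, j div dim_col B) * B $$ (i mod dim_row B, j mod dim_col B))"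

definition ptrace_B :: "nat \<Rightarrow> complex mat \<Rightarrow> complex mat" where
  "ptrace_B D M = mat D D (\<lambda>(a, a'). \<Sum>b<D. M $$ (a * D + b, a' * D + b))"

definition U_map :: "nat \<Rightarrow> nat \<Rightarrow> int \<Rightarrow> int \<Rightarrow> int \<Rightarrow> int \<Rightarrow> nat \<Rightarrow> nat" where
  "U_map d n g00 g01 g10 g11 c =
     (let D = d ^ n; N = modular_inverse (int d) (g00 * g11 - g01 * g10);
          a = c div D; b = c mod D
      in enc d n (\<lambda>k. N * g11 * dig d k a - N * g10 * dig d k b) * D
         + enc d n (\<lambda>k. - N * g01 * dig d k a + N * g00 * dig d k b))"

definition U_mat :: "nat \<Rightarrow> nat \<Rightarrow> int \<Rightarrow> int \<Rightarrow> int \<Rightarrow> int \<Rightarrow> complex mat" where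
  "U_mat d n g00 g01 g10 g11 = mat (d ^ n * d ^ n) (d ^ n * d ^ n)
     (\<lambda>(r, c). if r = U_map d n g00 g01 g10 g11 c then 1 else 0)"

definition qconv :: "nat \<Rightarrow> nat \<Rightarrow> int \<Rightarrow> int \<Rightarrow> int \<Rightarrow> int \<Rightarrow> complex mat \<Rightarrow> complex mat \<Rightarrow> complex mat" where
  "qconv d n g00 g01 g10 g11 \<rho> \<sigma> =
     (let U = U_mat d n g00 g01 g10 g11 in ptrace_B (d ^ n) (U * kron \<rho> \<sigma> * adj U))"

text \<open>von Neumann entropy: - sum over eigenvalues (with multiplicity, roots of the
  characteristic polynomial) of lambda ln lambda; note ln 0 = 0 in Isabelle.\<close>
definition vN_entropy :: "complex mat \<Rightarrow> real" where
  "vN_entropy \<rho> = - (\<Sum>x\<in>#proots (char_poly \<rho>). Re x * ln (Re x))"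

definition stab_map :: "nat \<Rightarrow> int \<Rightarrow> int \<Rightarrow> int \<Rightarrow> int \<Rightarrow>
    (nat \<Rightarrow> int) \<times> (nat \<Rightarrow> int) \<Rightarrow> (nat \<Rightarrow> int) \<times> (nat \<Rightarrow> int)" where
  "stab_map d g00 g01 g10 g11 pq =
     ((\<lambda>k. (- modular_inverse (int d) g10 * g11 * fst pq k) mod int d),
      (\<lambda>k. (modular_inverse (int d) g01 * g00 * snd pq k) mod int d))"

end

theory Submission
  imports Defs "Jordan_Normal_Form.Schur_Decomposition"
begin

text \<open>
  Write \<open>F(p, q)\<close> for the trace of \<open>\<rho> Z\<^sup>p X\<^sup>q\<close>. For every state \<open>|F| \<le> 1\<close>, and by Parseval the sum
  of \<open>|F|\<^sup>2\<close> over all labels is \<open>d\<^sup>n\<close> times the purity, hence at most \<open>d\<^sup>n\<close>. For a pure state, the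
  equality case of Cauchy--Schwarz gives \<open>|F| = 1\<close> exactly at the Weyl operators having the state
  vector as eigenvector, so \<open>\<rho>\<close> is a stabilizer state with group \<open>S\<close> iff \<open>|F|\<close> is the indicator
  function of \<open>S\<close> and \<open>S\<close> has \<open>d\<^sup>n\<close> elements. Under convolution the characteristic functions
  multiply, after a linear change of labels which \<open>stab_map\<close> describes. So the convolution is pure
  iff the sum of \<open>f g\<close> is \<open>d\<^sup>n\<close> for two functions \<open>f\<close>, \<open>g\<close> with values in \<open>[0, 1]\<close> and sums at
  most \<open>d\<^sup>n\<close>, which forces both to be the indicator function of one set of \<open>d\<^sup>n\<close> labels.
\<close>

section \<open>Positive semidefinite kernels\<close>

definition quad_form :: "'a set \<Rightarrow> ('a \<Rightarrow> 'a \<Rightarrow> complex) \<Rightarrow> ('a \<Rightarrow> complex) \<Rightarrow> complex" where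
  "quad_form I K f = (\<Sum>i\<in>I. \<Sum>j\<in>I. cnj (f i) * K i j * f j)"

definition psd_kernel :: "'a set \<Rightarrow> ('a \<Rightarrow> 'a \<Rightarrow> complex) \<Rightarrow> bool" where
  "psd_kernel I K \<longleftrightarrow> (\<forall>i\<in>I. \<forall>j\<in>I. K j i = cnj (K i j)) \<and> (\<forall>f. 0 \<le> Re (quad_form I K f))"

definition purity :: "'a set \<Rightarrow> ('a \<Rightarrow> 'a \<Rightarrow> complex) \<Rightarrow> real" where
  "purity I K = (\<Sum>i\<in>I. \<Sum>j\<in>I. (cmod (K i j))\<^sup>2)"

lemma psd_kernel_cnj: "psd_kernel I K \<Longrightarrow> i \<in> I \<Longrightarrow> j \<in> I \<Longrightarrow> cnj (K i j) = K j i"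
  unfolding psd_kernel_def by (metis complex_cnj_cnj)

lemma psd_kernel_quad_form_nonneg: "psd_kernel I K \<Longrightarrow> 0 \<le> Re (quad_form I K f)"
  unfolding psd_kernel_def by blast

lemma psd_kernel_cong:
  assumes "\<And>i j. i \<in> I \<Longrightarrow> j \<in> I \<Longrightarrow> K i j = L i j"
  shows "psd_kernel I K \<longleftrightarrow> psd_kernel I L"
proof -
  have "quad_form I K f = quad_form I L f" for f
    unfolding quad_form_def using assms by (intro sum.cong) auto
  then show ?thesis unfolding psd_kernel_def using assms by auto
qed

lemma psd_kernel_cnj_quad_form:
  assumes "psd_kernel I K"
  shows "cnj (quad_form I K f) = quad_form I K f"
proof -
  have "cnj (quad_form I K f) = (\<Sum>i\<in>I. \<Sum>j\<in>I. cnj (f j) * K j i * f i)"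
    unfolding quad_form_def cnj_sum
    by (intro sum.cong) (auto simp: psd_kernel_cnj[OF assms] mult_ac)
  also have "\<dots> = quad_form I K f"
    unfolding quad_form_def by (rule sum.swap)
  finally show ?thesis .
qed

lemma quad_form_single:
  assumes "finite I" "j \<in> I"
  shows "quad_form I K (\<lambda>a. if a = j then z else 0) = cnj z * z * K j j"
proof -
  have "cnj (if a = j then z else 0) * K a b * (if b = j then z else 0)
      = (if b = j then if a = j then cnj z * z * K j j else 0 else 0)" for a b
    by simp
  then show ?thesis
    using assms by (simp add: quad_form_def)
qed

lemma quad_form_diff_single:
  assumes "finite I" "i \<in> I"
  shows "quad_form I K (\<lambda>a. f a - (if a = i then t else 0)) =
    quad_form I K f - cnj t * (\<Sum>b\<in>I. K i b * f b) - t * (\<Sum>a\<in>I. cnj (f a) * K a i)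
      + cnj t * t * K i i"
proof -
  have "cnj (f a - (if a = i then t else 0)) * K a b * (f b - (if b = i then t else 0)) =
      cnj (f a) * K a b * f b - (if a = i then cnj t * (K i b * f b) else 0)
        - (if b = i then t * (cnj (f a) * K a i) else 0)
        + (if b = i then if a = i then cnj t * t * K i i else 0 else 0)" for a b
    by (simp add: algebra_simps)
  moreover have "(\<Sum>a\<in>I. \<Sum>b\<in>I. if a = i then cnj t * (K i b * f b) else 0)
      = cnj t * (\<Sum>b\<in>I. K i b * f b)"
    using assms by (subst sum.swap) (simp add: sum_distrib_left)
  ultimately show ?thesis
    using assms by (simp add: quad_form_def sum.distrib sum_subtractf sum_distrib_left)
qed

lemma psd_kernel_diag:
  assumes "finite I" "psd_kernel I K" "i \<in> I"
  shows "K i i = of_real (Re (K i i))" "0 \<le> Re (K i i)"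
proof -
  show "K i i = of_real (Re (K i i))"
    using psd_kernel_cnj[OF assms(2,3,3)] by (simp add: complex_eq_iff)
  show "0 \<le> Re (K i i)"
    using psd_kernel_quad_form_nonneg[OF assms(2), of "\<lambda>a. if a = i then 1 else 0"] assms(1,3)
    by (simp add: quad_form_single)
qed

lemma psd_kernel_quadratic_nonneg:
  assumes "finite I" "psd_kernel I K" "i \<in> I" "j \<in> I"
  shows "0 \<le> Re (K j j) - 2 * r * (cmod (K i j))\<^sup>2 + r\<^sup>2 * (cmod (K i j))\<^sup>2 * Re (K i i)"
proof -
  define t where "t = of_real r * K i j"
  let ?e = "\<lambda>b. if b = j then 1 else (0::complex)"
  have K_ji: "K j i = cnj (K i j)"
    using psd_kernel_cnj[OF assms(2-4)] by simp
  have "(\<Sum>b\<in>I. K i b * ?e b) = (\<Sum>b\<in>I. if b = j then K i j else 0)"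
    "(\<Sum>a\<in>I. cnj (?e a) * K a i) = (\<Sum>a\<in>I. if a = j then K j i else 0)"
    by (intro sum.cong; simp)+
  then have "quad_form I K (\<lambda>a. ?e a - (if a = i then t else 0))
      = K j j - cnj t * K i j - t * K j i + cnj t * t * K i i"
    using assms by (simp add: quad_form_diff_single quad_form_single)
  also have "\<dots> = K j j - 2 * of_real r * (K i j * cnj (K i j))
      + (of_real r)\<^sup>2 * (K i j * cnj (K i j)) * K i i"
    by (simp add: t_def K_ji power2_eq_square algebra_simps)
  also have "\<dots> = of_real (Re (K j j) - 2 * r * (cmod (K i j))\<^sup>2
      + r\<^sup>2 * (cmod (K i j))\<^sup>2 * Re (K i i))"
    using psd_kernel_diag(1)[OF assms(1,2)] assms(3,4)
    by (simp flip: complex_norm_square)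
  finally show ?thesis
    using psd_kernel_quad_form_nonneg[OF assms(2), of "\<lambda>a. ?e a - (if a = i then t else 0)"]
    by simp
qed

lemma psd_kernel_norm_square_le:
  assumes "finite I" "psd_kernel I K" "i \<in> I" "j \<in> I"
  shows "(cmod (K i j))\<^sup>2 \<le> Re (K i i) * Re (K j j)"
proof (cases "Re (K i i) = 0")
  case True
  have "K i j = 0"
  proof (rule ccontr)
    assume "K i j \<noteq> 0"
    then show False
      using psd_kernel_quadratic_nonneg[OF assms, of "(Re (K j j) + 1) / (cmod (K i j))\<^sup>2"]
        psd_kernel_diag(2)[OF assms(1,2,4)] True by simp
  qed
  then show ?thesis using True by simp
next
  case False
  then have "0 < Re (K i i)"
    using psd_kernel_diag(2)[OF assms(1-3)] by simp
  moreover have "0 \<le> Re (K j j) - (cmod (K i j))\<^sup>2 / Re (K i i)"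
    using psd_kernel_quadratic_nonneg[OF assms, of "1 / Re (K i i)"] False
    by (simp add: power2_eq_square)
  ultimately show ?thesis by (simp add: field_simps)
qed

lemma psd_kernel_eq_0:
  assumes "finite I" "psd_kernel I K" "i \<in> I" "j \<in> I" "K i i = 0"
  shows "K i j = 0"
  using psd_kernel_norm_square_le[OF assms(1-4)] assms(5) by simp

lemma psd_kernel_norm_le_mean:
  assumes "finite I" "psd_kernel I K" "i \<in> I" "j \<in> I"
  shows "cmod (K i j) \<le> (Re (K i i) + Re (K j j)) / 2"
proof (rule power2_le_imp_le)
  have "0 \<le> (Re (K i i) - Re (K j j))\<^sup>2" by simp
  then have "Re (K i i) * Re (K j j) \<le> ((Re (K i i) + Re (K j j)) / 2)\<^sup>2"
    by (simp add: power2_eq_square algebra_simps)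
  with psd_kernel_norm_square_le[OF assms]
  show "(cmod (K i j))\<^sup>2 \<le> ((Re (K i i) + Re (K j j)) / 2)\<^sup>2"
    by linarith
  show "0 \<le> (Re (K i i) + Re (K j j)) / 2"
    using psd_kernel_diag(2)[OF assms(1,2)] assms(3,4) by simp
qed

definition schur_complement :: "('a \<Rightarrow> 'a \<Rightarrow> complex) \<Rightarrow> 'a \<Rightarrow> 'a \<Rightarrow> 'a \<Rightarrow> complex" where
  "schur_complement K i a b = K a b - K a i * K i b / K i i"

lemma psd_kernel_schur_complement:
  assumes "finite I" "psd_kernel I K" "i \<in> I" "K i i \<noteq> 0"
  shows "psd_kernel I (schur_complement K i)"
  unfolding psd_kernel_def
proof (intro conjI ballI allI)
  fix a b assume "a \<in> I" "b \<in> I"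
  then show "schur_complement K i b a = cnj (schur_complement K i a b)"
    using assms by (simp add: schur_complement_def psd_kernel_cnj mult.commute)
next
  fix f
  define s where "s = (\<Sum>b\<in>I. K i b * f b)"
  have cnj_s: "(\<Sum>a\<in>I. cnj (f a) * K a i) = cnj s"
    unfolding s_def cnj_sum using assms by (intro sum.cong) (auto simp: psd_kernel_cnj)
  have "quad_form I (schur_complement K i) f
      = quad_form I K f - (\<Sum>a\<in>I. \<Sum>b\<in>I. (cnj (f a) * K a i) * (K i b * f b)) / K i i"
    by (simp add: quad_form_def schur_complement_def algebra_simps sum_subtractf sum_divide_distrib)
  also have "\<dots> = quad_form I K f - cnj s * s / K i i"
    by (simp only: sum_product[symmetric] cnj_s s_def[symmetric])
  also have "\<dots> = quad_form I K (\<lambda>a. f a - (if a = i then s / K i i else 0))"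
    unfolding quad_form_diff_single[OF assms(1,3)] s_def[symmetric] cnj_s
    using assms(4) by (simp add: psd_kernel_cnj[OF assms(2,3,3)] field_simps)
  finally show "0 \<le> Re (quad_form I (schur_complement K i) f)"
    using psd_kernel_quad_form_nonneg[OF assms(2)] by simp
qed

lemma psd_kernel_eq_schur_complement_add:
  assumes "finite I" "psd_kernel I K" "i \<in> I"
  obtains v where "\<And>a b. a \<in> I \<Longrightarrow> b \<in> I \<Longrightarrow> K a b = schur_complement K i a b + v a * cnj (v b)"
proof
  fix a b assume "a \<in> I" "b \<in> I"
  let ?v = "\<lambda>a. K a i / of_real (sqrt (Re (K i i)))"
  have "of_real (sqrt (Re (K i i))) * of_real (sqrt (Re (K i i))) = K i i"
    using psd_kernel_diag[OF assms] by (simp flip: of_real_mult)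
  then have "?v a * cnj (?v b) = K a i * K i b / K i i"
    using psd_kernel_cnj[OF assms(2) \<open>b \<in> I\<close> assms(3)] by simp
  then show "K a b = schur_complement K i a b + ?v a * cnj (?v b)"
    by (simp add: schur_complement_def)
qed

lemma schur_complement_diag_support:
  assumes "finite I" "psd_kernel I K" "i \<in> I" "K i i \<noteq> 0"
  shows "{a \<in> I. schur_complement K i a a \<noteq> 0} \<subset> {a \<in> I. K a a \<noteq> 0}"
proof -
  have "schur_complement K i i i = 0"
    using assms(4) by (simp add: schur_complement_def)
  moreover have "schur_complement K i a a = 0" if "a \<in> I" "K a a = 0" for a
    using psd_kernel_eq_0[OF assms(1,2) that(1) assms(3) that(2)] that(2)
    by (simp add: schur_complement_def)
  ultimately show ?thesis using assms(3,4) by blast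
qed

lemma psd_kernel_gram_decomposition:
  assumes "finite I" "psd_kernel I K"
  shows "\<exists>(m::nat) u. \<forall>i\<in>I. \<forall>j\<in>I. K i j = (\<Sum>k<m. u k i * cnj (u k j))"
  using assms(2)
proof (induction "card {i \<in> I. K i i \<noteq> 0}" arbitrary: K rule: less_induct)
  case less
  show ?case
  proof (cases "\<exists>i\<in>I. K i i \<noteq> 0")
    case False
    then show ?thesis
      using psd_kernel_eq_0[OF assms(1) less.prems] by (intro exI[of _ 0]) auto
  next
    case True
    then obtain i where i: "i \<in> I" "K i i \<noteq> 0" by blast
    obtain v where v: "K a b = schur_complement K i a b + v a * cnj (v b)"
      if "a \<in> I" "b \<in> I" for a b
      using psd_kernel_eq_schur_complement_add[OF assms(1) less.prems i(1)] by blast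
    have "card {a \<in> I. schur_complement K i a a \<noteq> 0} < card {a \<in> I. K a a \<noteq> 0}"
      using schur_complement_diag_support[OF assms(1) less.prems i] assms(1)
      by (intro psubset_card_mono) auto
    then obtain m :: nat and u where
      u: "\<forall>a\<in>I. \<forall>b\<in>I. schur_complement K i a b = (\<Sum>k<m. u k a * cnj (u k b))"
      using less.hyps psd_kernel_schur_complement[OF assms(1) less.prems i] by blast
    define w where "w = u(m := v)"
    have "K a b = (\<Sum>k<Suc m. w k a * cnj (w k b))" if "a \<in> I" "b \<in> I" for a b
      using that by (simp add: v u w_def)
    then show ?thesis by blast
  qed
qed

lemma quad_form_sum: "quad_form I (\<lambda>i j. \<Sum>b\<in>B. K b i j) f = (\<Sum>b\<in>B. quad_form I (K b) f)"
  unfolding quad_form_def sum_distrib_left sum_distrib_right by (simp only: sum.swap[of _ B])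

lemma psd_kernel_sum:
  assumes "\<And>b. b \<in> B \<Longrightarrow> psd_kernel I (K b)"
  shows "psd_kernel I (\<lambda>i j. \<Sum>b\<in>B. K b i j)"
  unfolding psd_kernel_def quad_form_sum
proof (intro conjI ballI allI)
  show "(\<Sum>b\<in>B. K b j i) = cnj (\<Sum>b\<in>B. K b i j)" if "i \<in> I" "j \<in> I" for i j
    using that by (simp add: psd_kernel_cnj[OF assms])
  show "0 \<le> Re (\<Sum>b\<in>B. quad_form I (K b) f)" for f
    by (simp add: sum_nonneg psd_kernel_quad_form_nonneg assms)
qed

lemma psd_kernel_compose:
  fixes I :: "'a set"
  assumes "finite I" "finite J" "psd_kernel J K" "\<phi> ` I \<subseteq> J"
  shows "psd_kernel I (\<lambda>a b. K (\<phi> a) (\<phi> b))"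
  unfolding psd_kernel_def
proof (intro conjI ballI allI)
  show "K (\<phi> b) (\<phi> a) = cnj (K (\<phi> a) (\<phi> b))" if "a \<in> I" "b \<in> I" for a b
    using that assms(3,4) by (simp add: psd_kernel_cnj image_subset_iff)
next
  fix f :: "'a \<Rightarrow> complex"
  define F where "F j = (\<Sum>i | i \<in> I \<and> \<phi> i = j. f i)" for j
  have fibers: "(\<Sum>i\<in>I. g (\<phi> i) * h i) = (\<Sum>j\<in>J. g j * (\<Sum>i | i \<in> I \<and> \<phi> i = j. h i))"
    for g h :: "_ \<Rightarrow> complex"
    unfolding sum.group[OF assms(1,2,4), symmetric] sum_distrib_left by (intro sum.cong) auto
  have "quad_form I (\<lambda>a b. K (\<phi> a) (\<phi> b)) f
      = (\<Sum>a\<in>I. (\<Sum>b\<in>I. K (\<phi> a) (\<phi> b) * f b) * cnj (f a))"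
    by (simp add: quad_form_def sum_distrib_left mult_ac)
  also have "\<dots> = (\<Sum>a\<in>I. (\<Sum>j\<in>J. K (\<phi> a) j * F j) * cnj (f a))"
    by (simp only: fibers F_def)
  also have "\<dots> = (\<Sum>i\<in>J. (\<Sum>j\<in>J. K i j * F j) * cnj (F i))"
    unfolding F_def cnj_sum by (rule fibers)
  also have "\<dots> = quad_form J K F"
    by (simp add: quad_form_def sum_distrib_left mult_ac)
  finally show "0 \<le> Re (quad_form I (\<lambda>a b. K (\<phi> a) (\<phi> b)) f)"
    using psd_kernel_quad_form_nonneg[OF assms(3)] by simp
qed

lemma psd_kernel_mult:
  assumes "finite I" "psd_kernel I K" "psd_kernel I L"
  shows "psd_kernel I (\<lambda>i j. K i j * L i j)"
  unfolding psd_kernel_def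
proof (intro conjI ballI allI)
  show "K j i * L j i = cnj (K i j * L i j)" if "i \<in> I" "j \<in> I" for i j
    using that assms by (simp add: psd_kernel_cnj)
next
  fix f
  obtain m :: nat and u where u: "\<forall>i\<in>I. \<forall>j\<in>I. K i j = (\<Sum>k<m. u k i * cnj (u k j))"
    using psd_kernel_gram_decomposition[OF assms(1,2)] by blast
  have "quad_form I (\<lambda>i j. K i j * L i j) f
      = quad_form I (\<lambda>i j. \<Sum>k<m. u k i * cnj (u k j) * L i j) f"
    unfolding quad_form_def using u by (intro sum.cong refl) (simp add: sum_distrib_right)
  also have "\<dots> = (\<Sum>k<m. quad_form I L (\<lambda>i. cnj (u k i) * f i))"
    unfolding quad_form_sum by (simp add: quad_form_def mult_ac)
  finally show "0 \<le> Re (quad_form I (\<lambda>i j. K i j * L i j) f)"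
    using psd_kernel_quad_form_nonneg[OF assms(3)] by (simp add: sum_nonneg)
qed

lemma psd_kernel_purity_le:
  assumes "finite I" "psd_kernel I K"
  shows "purity I K \<le> (\<Sum>i\<in>I. Re (K i i))\<^sup>2"
proof -
  have "purity I K \<le> (\<Sum>i\<in>I. \<Sum>j\<in>I. Re (K i i) * Re (K j j))"
    unfolding purity_def using assms by (intro sum_mono psd_kernel_norm_square_le)
  then show ?thesis by (simp add: power2_eq_square sum_product)
qed

lemma psd_kernel_norm_square_eq:
  assumes "finite I" "psd_kernel I K" "purity I K = (\<Sum>i\<in>I. Re (K i i))\<^sup>2" "i \<in> I" "j \<in> I"
  shows "(cmod (K i j))\<^sup>2 = Re (K i i) * Re (K j j)"
proof -
  let ?gap = "\<lambda>i j. Re (K i i) * Re (K j j) - (cmod (K i j))\<^sup>2"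
  have gap_nonneg: "0 \<le> ?gap a b" if "a \<in> I" "b \<in> I" for a b
    using psd_kernel_norm_square_le[OF assms(1,2) that] by simp
  have "(\<Sum>a\<in>I. \<Sum>b\<in>I. ?gap a b) = 0"
    using assms(3) by (simp add: purity_def power2_eq_square sum_product sum_subtractf)
  then have "(\<Sum>b\<in>I. ?gap i b) = 0"
    using gap_nonneg assms(1,4) by (simp add: sum_nonneg_eq_0_iff sum_nonneg)
  then have "?gap i j = 0"
    using gap_nonneg assms(1,4,5) by (simp add: sum_nonneg_eq_0_iff)
  then show ?thesis by simp
qed

text \<open>Maximal purity means equality in every 2-by-2 minor, so a Schur complement has zero diagonal
  and therefore vanishes.\<close>

lemma psd_kernel_rank_one:
  assumes fin: "finite I" and psd: "psd_kernel I K"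
    and pure: "purity I K = (\<Sum>i\<in>I. Re (K i i))\<^sup>2"
  obtains \<psi> where "\<And>i j. i \<in> I \<Longrightarrow> j \<in> I \<Longrightarrow> K i j = \<psi> i * cnj (\<psi> j)"
proof (cases "\<exists>i\<in>I. K i i \<noteq> 0")
  case False
  then show thesis
    using psd_kernel_eq_0[OF fin psd] that[of "\<lambda>_. 0"] by simp
next
  case True
  then obtain i where i: "i \<in> I" "K i i \<noteq> 0" by blast
  obtain \<psi> where \<psi>: "K a b = schur_complement K i a b + \<psi> a * cnj (\<psi> b)"
    if "a \<in> I" "b \<in> I" for a b
    using psd_kernel_eq_schur_complement_add[OF fin psd i(1)] by blast
  have "schur_complement K i a a = 0" if "a \<in> I" for a
  proof -
    have "K a i * K i a = of_real ((cmod (K a i))\<^sup>2)"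
      unfolding psd_kernel_cnj[OF psd that i(1), symmetric] complex_norm_square ..
    also have "\<dots> = of_real (Re (K a a)) * of_real (Re (K i i))"
      by (simp add: psd_kernel_norm_square_eq[OF fin psd pure that i(1)])
    also have "\<dots> = K a a * K i i"
      using psd_kernel_diag(1)[OF fin psd] that i(1) by simp
    finally show ?thesis using i(2) by (simp add: schur_complement_def)
  qed
  then have "schur_complement K i a b = 0" if "a \<in> I" "b \<in> I" for a b
    using psd_kernel_eq_0[OF fin psd_kernel_schur_complement[OF fin psd i] that] that by blast
  with \<psi> that[of \<psi>] show thesis by simp
qed

abbreviation entries :: "'a mat \<Rightarrow> nat \<Rightarrow> nat \<Rightarrow> 'a" where
  "entries A \<equiv> \<lambda>i j. A $$ (i, j)"

lemma adj_eq_iff: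
  assumes "A \<in> carrier_mat D D"
  shows "adj A = A \<longleftrightarrow> (\<forall>i\<in>{..<D}. \<forall>j\<in>{..<D}. A $$ (j, i) = cnj (A $$ (i, j)))"
proof -
  have "adj A = A \<longleftrightarrow> (\<forall>j<D. \<forall>i<D. cnj (A $$ (i, j)) = A $$ (j, i))"
    using assms by (simp add: adj_def mat_eq_iff)
  then show ?thesis by (metis lessThan_iff)
qed

lemma density_matrix_iff_psd_kernel:
  "density_matrix D A \<longleftrightarrow>
    A \<in> carrier_mat D D \<and> psd_kernel {..<D} (entries A) \<and> (\<Sum>i<D. A $$ (i, i)) = 1"
proof (cases "A \<in> carrier_mat D D")
  case True
  have "(\<forall>v \<in> carrier_vec D. 0 \<le> Re (\<Sum>i<D. \<Sum>j<D. cnj (v $ i) * A $$ (i, j) * v $ j)) \<longleftrightarrow>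
     (\<forall>f. 0 \<le> Re (quad_form {..<D} (entries A) f))" (is "?vectors \<longleftrightarrow> ?functions")
  proof
    assume vectors: ?vectors
    show ?functions
    proof
      fix f
      from vectors[rule_format, of "vec D f"]
      show "0 \<le> Re (quad_form {..<D} (entries A) f)"
        by (simp add: quad_form_def)
    qed
  qed (simp add: quad_form_def)
  moreover have "ctrace A = (\<Sum>i<D. A $$ (i, i))"
    using True by (simp add: ctrace_def)
  ultimately show ?thesis
    unfolding density_matrix_def psd_kernel_def adj_eq_iff[OF True] using True
    by (simp only: conj_assoc)
qed (simp add: density_matrix_def)

lemma density_matrix_pure:
  assumes "density_matrix D A" "purity {..<D} (entries A) = 1"
  obtains \<psi> where "\<psi> \<in> carrier_vec D" "(\<Sum>i<D. (cmod (\<psi> $ i))\<^sup>2) = 1" "A = proj_of D \<psi>"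
proof -
  have A: "A \<in> carrier_mat D D" and psd: "psd_kernel {..<D} (entries A)"
    and trace: "(\<Sum>i<D. A $$ (i, i)) = 1"
    using assms(1) by (auto simp: density_matrix_iff_psd_kernel)
  have "(\<Sum>i<D. Re (A $$ (i, i))) = 1" using trace by (simp flip: Re_sum)
  then have "purity {..<D} (entries A) = (\<Sum>i<D. Re (A $$ (i, i)))\<^sup>2" using assms(2) by simp
  from psd_kernel_rank_one[OF finite_lessThan psd this]
  obtain \<phi> where \<phi>: "\<And>i j. i \<in> {..<D} \<Longrightarrow> j \<in> {..<D} \<Longrightarrow> A $$ (i, j) = \<phi> i * cnj (\<phi> j)"
    by blast
  show thesis
  proof
    show "A = proj_of D (vec D \<phi>)"
      using A \<phi> by (intro eq_matI) (auto simp: proj_of_def)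
    have "complex_of_real (\<Sum>i<D. (cmod (\<phi> i))\<^sup>2) = 1"
      using trace \<phi> by (simp add: complex_norm_square del: of_real_power)
    then have "(\<Sum>i<D. (cmod (\<phi> i))\<^sup>2) = 1" by (simp only: of_real_eq_1_iff)
    then show "(\<Sum>i<D. (cmod (vec D \<phi> $ i))\<^sup>2) = 1" by simp
  qed simp
qed

section \<open>Entropy and purity\<close>

lemma ctrace_mult:
  assumes "A \<in> carrier_mat n m" "B \<in> carrier_mat m n"
  shows "ctrace (A * B) = (\<Sum>i<n. \<Sum>j<m. A $$ (i, j) * B $$ (j, i))"
  using assms by (auto simp: ctrace_def scalar_prod_def atLeast0LessThan intro!: sum.cong)

lemma ctrace_mult_commute:
  assumes "A \<in> carrier_mat n m" "B \<in> carrier_mat m n"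
  shows "ctrace (A * B) = ctrace (B * A)"
  unfolding ctrace_mult[OF assms] ctrace_mult[OF assms(2,1)]
  by (subst sum.swap) (simp add: mult.commute)

lemma ctrace_similar_mat_wit:
  assumes "A \<in> carrier_mat n n" "similar_mat_wit A B P Q"
  shows "ctrace A = ctrace B"
proof -
  note sim = similar_mat_witD2[OF assms]
  have "ctrace A = ctrace (Q * (P * B))"
    unfolding sim(3) using sim(5-7) by (intro ctrace_mult_commute[of _ n n]) auto
  also have "Q * (P * B) = B"
    using sim(2,5-7) by (simp flip: assoc_mult_mat)
  finally show ?thesis .
qed

lemma ctrace_eq_sum_list_diag_mat: "ctrace A = sum_list (diag_mat A)"
  by (simp add: ctrace_def diag_mat_def interv_sum_list_conv_sum_set_nat atLeast0LessThan)

lemma diag_mat_square_upper_triangular: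
  fixes B :: "complex mat"
  assumes B: "B \<in> carrier_mat n n" and "upper_triangular B"
  shows "diag_mat (B * B) = map (\<lambda>x. x\<^sup>2) (diag_mat B)"
proof -
  have "(B * B) $$ (i, i) = (B $$ (i, i))\<^sup>2" if "i < n" for i
  proof -
    have "(B * B) $$ (i, i) = (\<Sum>j<n. B $$ (i, j) * B $$ (j, i))"
      using B that by (simp add: scalar_prod_def atLeast0LessThan)
    also have "\<dots> = (\<Sum>j<n. if j = i then (B $$ (i, i))\<^sup>2 else 0)"
    proof (intro sum.cong refl)
      fix j assume "j \<in> {..<n}"
      then show "B $$ (i, j) * B $$ (j, i) = (if j = i then (B $$ (i, i))\<^sup>2 else 0)"
        using upper_triangularD[OF assms(2), of i j] upper_triangularD[OF assms(2), of j i] B that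
        by (cases i j rule: linorder_cases) (auto simp: power2_eq_square)
    qed
    finally show ?thesis using that by simp
  qed
  then show ?thesis using B by (simp add: diag_mat_def)
qed

lemma ctrace_eq_sum_eigenvalues:
  fixes A :: "complex mat"
  assumes A: "A \<in> carrier_mat n n" and es: "char_poly A = (\<Prod>e\<leftarrow>es. [:- e, 1:])"
  shows "ctrace A = sum_list es" "ctrace (A * A) = sum_list (map (\<lambda>x. x\<^sup>2) es)"
proof -
  obtain B P Q where "schur_decomposition A es = (B, P, Q)" by (metis prod_cases3)
  from schur_decomposition[OF A es this]
  have sim: "similar_mat_wit A B P Q" and tri: "upper_triangular B" and diag: "diag_mat B = es"
    by auto
  have B: "B \<in> carrier_mat n n" using similar_mat_witD2[OF A sim] by simp
  show "ctrace A = sum_list es"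
    using ctrace_similar_mat_wit[OF A sim] diag by (simp add: ctrace_eq_sum_list_diag_mat)
  have "similar_mat_wit (A * A) (B * B) P Q"
    using similar_mat_wit_pow[OF sim, of 2] A B by (simp add: numeral_2_eq_2)
  then show "ctrace (A * A) = sum_list (map (\<lambda>x. x\<^sup>2) es)"
    using ctrace_similar_mat_wit[of "A * A" n] A
    by (simp add: ctrace_eq_sum_list_diag_mat diag_mat_square_upper_triangular[OF B tri] diag)
qed

lemma psd_kernel_eigenvalue:
  assumes A: "A \<in> carrier_mat D D" and psd: "psd_kernel {..<D} (entries A)"
    and eigen: "eigenvalue A e"
  shows "e = of_real (Re e)" "0 \<le> Re e"
proof -
  from eigen A obtain v where v: "v \<in> carrier_vec D" "v \<noteq> 0\<^sub>v D" "A *\<^sub>v v = e \<cdot>\<^sub>v v"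
    unfolding eigenvalue_def eigenvector_def by auto
  define s where "s = (\<Sum>i<D. (cmod (v $ i))\<^sup>2)"
  obtain i where "i < D" "v $ i \<noteq> 0"
    using v(1,2) by (metis carrier_vecD eq_vecI index_zero_vec)
  then have s_pos: "0 < s"
    unfolding s_def by (intro sum_pos2[of _ i]) auto
  have row: "(\<Sum>j<D. A $$ (i, j) * v $ j) = e * v $ i" if "i < D" for i
  proof -
    have "(A *\<^sub>v v) $ i = (\<Sum>j<D. A $$ (i, j) * v $ j)"
      using A v(1) that by (simp add: scalar_prod_def atLeast0LessThan)
    then show ?thesis using v that by simp
  qed
  have "quad_form {..<D} (entries A) (($) v) = (\<Sum>i<D. cnj (v $ i) * (\<Sum>j<D. A $$ (i, j) * v $ j))"
    by (simp add: quad_form_def sum_distrib_left mult.assoc)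
  also have "\<dots> = (\<Sum>i<D. e * (v $ i * cnj (v $ i)))"
    by (intro sum.cong) (auto simp: row)
  finally have quad: "quad_form {..<D} (entries A) (($) v) = e * of_real s"
    by (simp add: s_def complex_norm_square sum_distrib_left flip: of_real_power)
  have "cnj e = e"
    using psd_kernel_cnj_quad_form[OF psd, of "($) v"] s_pos unfolding quad by simp
  then show "e = of_real (Re e)" by (simp add: complex_eq_iff)
  have "0 \<le> Re e * s"
    using psd_kernel_quad_form_nonneg[OF psd, of "($) v"] unfolding quad by simp
  then show "0 \<le> Re e" using s_pos by (simp add: zero_le_mult_iff)
qed

lemma proots_prod_list_linear: "proots (\<Prod>e\<leftarrow>es. [:- e, 1 :: complex:]) = mset es"
proof -
  have "proots (\<Prod>p\<leftarrow>map (\<lambda>e. [:- e, 1:]) es. p) = (\<Sum>p\<leftarrow>map (\<lambda>e. [:- e, 1:]) es. proots p)"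
    by (rule proots_prod_list) auto
  also have "\<dots> = mset es" by (induction es) auto
  finally show ?thesis by simp
qed

lemma ctrace_square_hermitian:
  assumes "A \<in> carrier_mat D D" "psd_kernel {..<D} (entries A)"
  shows "ctrace (A * A) = of_real (purity {..<D} (entries A))"
  unfolding ctrace_mult[OF assms(1,1)] purity_def of_real_sum
  by (intro sum.cong)
    (auto simp: complex_norm_square psd_kernel_cnj[OF assms(2)] simp del: of_real_power)

lemma density_matrix_spectrum:
  assumes "density_matrix D A"
  obtains xs where "proots (char_poly A) = mset (map of_real xs)" "\<And>x. x \<in> set xs \<Longrightarrow> 0 \<le> x"
    "sum_list xs = 1" "sum_list (map (\<lambda>x. x\<^sup>2) xs) = purity {..<D} (entries A)"
proof -
  have A: "A \<in> carrier_mat D D" and psd: "psd_kernel {..<D} (entries A)"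
    and trace: "(\<Sum>i<D. A $$ (i, i)) = 1"
    using assms by (auto simp: density_matrix_iff_psd_kernel)
  obtain es where es: "char_poly A = (\<Prod>e\<leftarrow>es. [:- e, 1:])"
    using char_poly_factorized[OF A] by auto
  define xs where "xs = map Re es"
  have "eigenvalue A e" if "e \<in> set es" for e
    unfolding eigenvalue_root_char_poly[OF A] es using that by (simp add: poly_prod_list_zero_iff)
  then have eigenvalues: "e = of_real (Re e)" "0 \<le> Re e" if "e \<in> set es" for e
    using psd_kernel_eigenvalue[OF A psd] that by blast+
  have es_eq: "es = map of_real xs"
    unfolding xs_def using eigenvalues(1) by (simp add: map_idI)
  show thesis
  proof
    show "proots (char_poly A) = mset (map of_real xs)"
      by (simp only: es proots_prod_list_linear es_eq)
    show "0 \<le> x" if "x \<in> set xs" for x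
      using eigenvalues(2) that by (auto simp: xs_def)
    have "complex_of_real (sum_list xs) = sum_list es"
      unfolding es_eq by (induction xs) auto
    also have "\<dots> = 1"
      using ctrace_eq_sum_eigenvalues(1)[OF A es] trace A by (simp add: ctrace_def)
    finally show "sum_list xs = 1" by simp
    have "complex_of_real (sum_list (map (\<lambda>x. x\<^sup>2) xs)) = sum_list (map (\<lambda>x. x\<^sup>2) es)"
      unfolding es_eq by (induction xs) auto
    also have "\<dots> = of_real (purity {..<D} (entries A))"
      using ctrace_eq_sum_eigenvalues(2)[OF A es] ctrace_square_hermitian[OF A psd] by simp
    finally show "sum_list (map (\<lambda>x. x\<^sup>2) xs) = purity {..<D} (entries A)"
      by (simp only: of_real_eq_iff)
  qed
qed

lemma entropy_eq_0_iff_sum_squares: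
  fixes xs :: "real list"
  assumes nonneg: "\<And>x. x \<in> set xs \<Longrightarrow> 0 \<le> x" and sum1: "sum_list xs = 1"
  shows "sum_list (map (\<lambda>x. - (x * ln x)) xs) = 0 \<longleftrightarrow> sum_list (map (\<lambda>x. x\<^sup>2) xs) = 1"
proof -
  have le1: "x \<le> 1" if "x \<in> set xs" for x
    using member_le_sum_list[OF that] sum1 nonneg by simp
  have "x * ln x \<le> 0" if "x \<in> set xs" for x
    using nonneg[OF that] le1[OF that] by (cases "x = 0") (auto intro: mult_nonneg_nonpos)
  then have "sum_list (map (\<lambda>x. - (x * ln x)) xs) = 0 \<longleftrightarrow> (\<forall>x\<in>set xs. x * ln x = 0)"
    by (subst sum_list_nonneg_eq_0_iff) auto
  also have "\<dots> \<longleftrightarrow> (\<forall>x\<in>set xs. x - x\<^sup>2 = 0)"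
  proof (intro ball_cong refl)
    fix x assume "x \<in> set xs"
    then have "0 \<le> x" by (rule nonneg)
    moreover have "x - x\<^sup>2 = x * (1 - x)" by (simp add: power2_eq_square algebra_simps)
    ultimately show "x * ln x = 0 \<longleftrightarrow> x - x\<^sup>2 = 0" by (cases "x = 0") auto
  qed
  also have "\<dots> \<longleftrightarrow> sum_list (map (\<lambda>x. x - x\<^sup>2) xs) = 0"
    using nonneg le1 by (subst sum_list_nonneg_eq_0_iff) (auto simp: power2_eq_square mult_left_le)
  finally show ?thesis
    using sum1 by (auto simp: sum_list_subtractf)
qed

lemma vN_entropy_eq_0_iff_purity:
  assumes "density_matrix D A"
  shows "vN_entropy A = 0 \<longleftrightarrow> purity {..<D} (entries A) = 1"
proof -
  obtain xs where roots: "proots (char_poly A) = mset (map of_real xs)"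
    and nonneg: "\<And>x. x \<in> set xs \<Longrightarrow> 0 \<le> x" and sum1: "sum_list xs = 1"
    and purity: "sum_list (map (\<lambda>x. x\<^sup>2) xs) = purity {..<D} (entries A)"
    using density_matrix_spectrum[OF assms] by blast
  have "vN_entropy A = sum_list (map (\<lambda>x. - (x * ln x)) xs)"
    unfolding vN_entropy_def roots
    by (simp add: sum_mset_sum_list o_def uminus_sum_list_map flip: mset_map)
  then show ?thesis
    using entropy_eq_0_iff_sum_squares[OF nonneg sum1] purity by simp
qed

section \<open>Base-\<open>d\<close> digits of basis indices\<close>

lemma digit_sum_bounds:
  fixes m :: "nat \<Rightarrow> int"
  assumes "\<And>k. k < n \<Longrightarrow> 0 \<le> m k \<and> m k < int d"
  shows "0 \<le> (\<Sum>k<n. m k * int d ^ k) \<and> (\<Sum>k<n. m k * int d ^ k) < int d ^ n"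
  using assms
proof (induction n)
  case (Suc n)
  then have IH: "0 \<le> (\<Sum>k<n. m k * int d ^ k)" "(\<Sum>k<n. m k * int d ^ k) < int d ^ n"
    and m: "0 \<le> m n" "m n \<le> int d - 1" using Suc.prems[of n] by auto
  have "m n * int d ^ n \<le> (int d - 1) * int d ^ n" using m(2) by (intro mult_right_mono) auto
  then show ?case using IH m(1) by (simp add: algebra_simps)
qed simp

lemma digit_sum_div_mod:
  fixes m :: "nat \<Rightarrow> int"
  assumes "\<And>k. k < n \<Longrightarrow> 0 \<le> m k \<and> m k < int d" "k < n" "d > 0"
  shows "(\<Sum>k<n. m k * int d ^ k) div int d ^ k mod int d = m k"
  using assms
proof (induction n)
  case (Suc n)
  let ?S = "\<Sum>k<n. m k * int d ^ k"
  have S: "0 \<le> ?S" "?S < int d ^ n" using digit_sum_bounds[of n m d] Suc.prems(1) by auto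
  show ?case
  proof (cases "k < n")
    case True
    then obtain l where l: "n = k + Suc l" using less_iff_Suc_add by auto
    have "m n * int d ^ n = (m n * int d ^ l * int d) * int d ^ k" by (simp add: l power_add)
    then have "(?S + m n * int d ^ n) div int d ^ k = ?S div int d ^ k + m n * int d ^ l * int d"
      using Suc.prems(3)
      by (simp only: div_mult_self1 power_not_zero of_nat_eq_0_iff not_False_eq_True neq0_conv)
    then show ?thesis using Suc True by simp
  next
    case False
    then have k: "k = n" using Suc.prems(2) by simp
    have "(?S + m n * int d ^ n) div int d ^ n = m n" using S Suc.prems(3) by simp
    then show ?thesis using Suc.prems(1)[of n] by (simp add: k)
  qed
qed simp

type_synonym label = "(nat \<Rightarrow> int) \<times> (nat \<Rightarrow> int)"

definition digits :: "nat \<Rightarrow> nat \<Rightarrow> (nat \<Rightarrow> int) set" where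
  "digits d n = {p. \<forall>k. (k < n \<longrightarrow> 0 \<le> p k \<and> p k < int d) \<and> (n \<le> k \<longrightarrow> p k = 0)}"

lemma labels_eq_Times: "labels d n = digits d n \<times> digits d n"
  by (auto simp: labels_def digits_def)

lemma digits_mod: "p \<in> digits d n \<Longrightarrow> p k mod int d = p k"
  by (cases "k < n") (simp_all add: digits_def)

locale qudits =
  fixes d n :: nat
  assumes d_pos [simp]: "d > 0"
begin

abbreviation D :: nat where "D \<equiv> d ^ n"

lemma d_neq_0 [simp]: "d \<noteq> 0"
  using d_pos by (rule less_imp_neq[symmetric])

lemma enc_less [simp]: "enc d n f < D"
  using digit_sum_bounds[of n "\<lambda>k. f k mod int d" d] by (simp add: enc_def nat_less_iff)

lemma enc_cong:
  "(\<And>k. k < n \<Longrightarrow> [f k = g k] (mod int d)) \<Longrightarrow> enc d n f = enc d n g"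
  unfolding enc_def cong_def by (intro arg_cong[of _ _ nat] sum.cong) auto

lemma dig_enc:
  assumes "k < n"
  shows "[dig d k (enc d n f) = f k] (mod int d)"
proof -
  have "0 \<le> (\<Sum>k<n. f k mod int d * int d ^ k)"
    using digit_sum_bounds[of n "\<lambda>k. f k mod int d" d] by simp
  then show ?thesis
    using digit_sum_div_mod[of n "\<lambda>k. f k mod int d" d k] assms
    by (simp add: dig_def enc_def of_nat_mod of_nat_div)
qed

lemma dig_mod [simp]: "dig d k i mod int d = dig d k i"
  by (simp add: dig_def)

lemma enc_dig:
  assumes "i < D"
  shows "enc d n (\<lambda>k. dig d k i) = i"
proof -
  have "(\<Sum>k<m. dig d k i * int d ^ k) = int i mod int d ^ m" for m
  proof (induction m)
    case (Suc m)
    have "int i mod (int d ^ m * int d) =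
        int d ^ m * (int i div int d ^ m mod int d) + int i mod int d ^ m"
      by (rule zmod_zmult2_eq) simp
    then show ?case using Suc by (simp add: dig_def of_nat_mod of_nat_div mult_ac)
  qed simp
  from this[of n] have "(\<Sum>k<n. dig d k i * int d ^ k) = int i mod int (d ^ n)" by simp
  also have "\<dots> = int i" using assms by (metis mod_less of_nat_mod)
  finally show ?thesis by (simp add: enc_def)
qed

lemma enc_eqI:
  assumes "i < D" "\<And>k. k < n \<Longrightarrow> [f k = dig d k i] (mod int d)"
  shows "enc d n f = i"
  using enc_cong[OF assms(2)] enc_dig[OF assms(1)] by simp

lemma index_eqI:
  assumes "i < D" "j < D" "\<And>k. k < n \<Longrightarrow> [dig d k i = dig d k j] (mod int d)"
  shows "i = j"
  using enc_eqI[OF assms(2,3)] enc_dig[OF assms(1)] by simp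

definition unshift :: "nat \<Rightarrow> (nat \<Rightarrow> int) \<Rightarrow> nat" where
  "unshift i q = enc d n (\<lambda>k. dig d k i - q k)"

lemma unshift_less [simp]: "unshift i q < D"
  by (simp add: unshift_def)

lemma dig_unshift: "k < n \<Longrightarrow> [dig d k (unshift i q) = dig d k i - q k] (mod int d)"
  unfolding unshift_def by (rule dig_enc)

lemma unshift_cong:
  "(\<And>k. k < n \<Longrightarrow> [q k = q' k] (mod int d)) \<Longrightarrow> unshift i q = unshift i q'"
  unfolding unshift_def by (intro enc_cong cong_diff cong_refl)

lemma unshift_eq_iff:
  assumes "j < D"
  shows "unshift i q = j \<longleftrightarrow> (\<forall>k<n. [dig d k i = dig d k j + q k] (mod int d))"
proof -
  have "[dig d k i = dig d k j + q k] (mod int d) \<longleftrightarrow> [dig d k i - q k = dig d k j] (mod int d)" for k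
    by (simp add: cong_iff_dvd_diff algebra_simps)
  moreover have "unshift i q = j \<longleftrightarrow> (\<forall>k<n. [dig d k i - q k = dig d k j] (mod int d))"
  proof
    assume "unshift i q = j"
    then show "\<forall>k<n. [dig d k i - q k = dig d k j] (mod int d)"
      using dig_unshift cong_sym by blast
  next
    assume "\<forall>k<n. [dig d k i - q k = dig d k j] (mod int d)"
    then show "unshift i q = j"
      unfolding unshift_def by (intro enc_eqI assms) simp
  qed
  ultimately show ?thesis by simp
qed

lemma unshift_unshift: "unshift (unshift i q) q' = unshift i (\<lambda>k. q k + q' k)"
proof -
  have "[dig d k (unshift i q) - q' k = dig d k i - (q k + q' k)] (mod int d)" if "k < n" for k
    using cong_diff[OF dig_unshift[OF that] cong_refl, of i q "q' k"] by (simp add: diff_diff_eq)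
  then show ?thesis unfolding unshift_def[of "unshift i q"] unshift_def[of i "\<lambda>k. q k + q' k"]
    by (rule enc_cong)
qed

lemma unshift_0: "i < D \<Longrightarrow> unshift i (\<lambda>k. 0) = i"
  by (simp add: unshift_eq_iff)

lemma bij_betw_unshift: "bij_betw (\<lambda>i. unshift i q) {..<D} {..<D}"
  by (rule bij_betwI[where g = "\<lambda>i. unshift i (\<lambda>k. - q k)"]) (auto simp: unshift_unshift unshift_0)

lemma bij_betw_unshift_digits: "bij_betw (unshift r) (digits d n) {..<D}"
proof (rule bij_betwI[where g = "\<lambda>i k. if k < n then (dig d k r - dig d k i) mod int d else 0"])
  fix i assume "i \<in> {..<D}"
  then show "unshift r (\<lambda>k. if k < n then (dig d k r - dig d k i) mod int d else 0) = i"
    by (simp add: unshift_eq_iff cong_def mod_simps)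
next
  fix q assume q: "q \<in> digits d n"
  have "(dig d k r - dig d k (unshift r q)) mod int d = q k" if "k < n" for k
    using cong_diff[OF cong_refl[of "dig d k r"] dig_unshift[OF that, of r q]]
      digits_mod[OF q, of k]
    by (simp add: cong_def)
  then show "(\<lambda>k. if k < n then (dig d k r - dig d k (unshift r q)) mod int d else 0) = q"
    using q by (auto simp: digits_def)
qed (auto simp: digits_def)

lemma finite_digits [simp]: "finite (digits d n)"
  using bij_betw_finite[OF bij_betw_unshift_digits] by simp

lemma card_digits: "card (digits d n) = D"
  using bij_betw_same_card[OF bij_betw_unshift_digits] by simp

lemma finite_labels [simp]: "finite (labels d n)"
  by (simp add: labels_eq_Times)

definition lin_index :: "int \<Rightarrow> int \<Rightarrow> nat \<Rightarrow> nat \<Rightarrow> nat" where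
  "lin_index u v i j = enc d n (\<lambda>k. u * dig d k i + v * dig d k j)"

lemma lin_index_less [simp]: "lin_index u v i j < D"
  by (simp add: lin_index_def)

lemma dig_lin_index:
  "k < n \<Longrightarrow> [dig d k (lin_index u v i j) = u * dig d k i + v * dig d k j] (mod int d)"
  unfolding lin_index_def by (rule dig_enc)

lemma lin_index_eq_fst:
  assumes "[u = 1] (mod int d)" "[v = 0] (mod int d)" "i < D"
  shows "lin_index u v i j = i"
  unfolding lin_index_def
proof (rule enc_eqI[OF assms(3)])
  fix k
  have "[u * dig d k i + v * dig d k j = 1 * dig d k i + 0 * dig d k j] (mod int d)"
    by (intro cong_add cong_mult assms cong_refl)
  then show "[u * dig d k i + v * dig d k j = dig d k i] (mod int d)" by simp
qed

lemma lin_index_eq_snd: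
  assumes "[u = 0] (mod int d)" "[v = 1] (mod int d)" "j < D"
  shows "lin_index u v i j = j"
  using lin_index_eq_fst[OF assms(2,1,3), of i] by (simp add: lin_index_def add.commute)

lemma lin_index_lin_index:
  "lin_index u v (lin_index a b i j) (lin_index c e i j) =
    lin_index (u * a + v * c) (u * b + v * e) i j"
  unfolding lin_index_def[of u] lin_index_def[of "u * a + v * c"]
proof (rule enc_cong)
  fix k assume "k < n"
  then have "[u * dig d k (lin_index a b i j) + v * dig d k (lin_index c e i j) =
      u * (a * dig d k i + b * dig d k j) + v * (c * dig d k i + e * dig d k j)] (mod int d)"
    by (intro cong_add cong_mult cong_refl dig_lin_index)
  then show "[u * dig d k (lin_index a b i j) + v * dig d k (lin_index c e i j) =
      (u * a + v * c) * dig d k i + (u * b + v * e) * dig d k j] (mod int d)"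
    by (simp add: algebra_simps)
qed

lemma lin_index_adjugate:
  assumes "[N * (a * e - b * c) = 1] (mod int d)" "i < D" "j < D"
  shows "lin_index (N * e) (- (N * b)) (lin_index a b i j) (lin_index c e i j) = i"
    and "lin_index (- (N * c)) (N * a) (lin_index a b i j) (lin_index c e i j) = j"
    and "lin_index a b (lin_index (N * e) (- (N * b)) i j) (lin_index (- (N * c)) (N * a) i j) = i"
    and "lin_index c e (lin_index (N * e) (- (N * b)) i j) (lin_index (- (N * c)) (N * a) i j) = j"
  unfolding lin_index_lin_index using assms
  by (auto intro!: lin_index_eq_fst lin_index_eq_snd simp: algebra_simps)

lemma lin_index_unshift:
  "lin_index u v (unshift i q) j = unshift (lin_index u v i j) (\<lambda>k. u * q k)"
  unfolding lin_index_def[of u v "unshift i q"]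
    unshift_def[of "lin_index u v i j"]
proof (rule enc_cong)
  fix k assume k: "k < n"
  have "[u * dig d k (unshift i q) + v * dig d k j
      = u * (dig d k i - q k) + v * dig d k j] (mod int d)"
    by (intro cong_add cong_mult cong_refl dig_unshift k)
  also have "u * (dig d k i - q k) + v * dig d k j = u * dig d k i + v * dig d k j - u * q k"
    by (simp add: algebra_simps)
  also have "[\<dots> = dig d k (lin_index u v i j) - u * q k] (mod int d)"
    by (intro cong_diff cong_refl cong_sym[OF dig_lin_index] k)
  finally show "[u * dig d k (unshift i q) + v * dig d k j
      = dig d k (lin_index u v i j) - u * q k] (mod int d)" .
qed

end

section \<open>Characters and the Parseval identity\<close>

lemma chi_eq_cis: "chi d k = cis (2 * pi * of_int k / of_nat d)"
  by (simp add: chi_def cis_conv_exp mult_ac)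

lemma chi_add: "chi d (a + b) = chi d a * chi d b"
  by (simp add: chi_eq_cis cis_mult ring_distribs add_divide_distrib)

lemma chi_0 [simp]: "chi d 0 = 1"
  by (simp add: chi_def)

lemma chi_minus: "chi d (- a) = cnj (chi d a)"
  by (simp add: chi_eq_cis cis_cnj)

lemma chi_sum: "chi d (\<Sum>k\<in>A. f k) = (\<Prod>k\<in>A. chi d (f k))"
  by (induction A rule: infinite_finite_induct) (auto simp: chi_add)

lemma norm_chi [simp]: "cmod (chi d a) = 1"
  by (simp add: chi_eq_cis)

lemma chi_eq_1_iff:
  assumes "d > 0"
  shows "chi d a = 1 \<longleftrightarrow> int d dvd a"
proof -
  have "chi d a = 1 \<longleftrightarrow> cos (2 * pi * of_int a / of_nat d) = 1"
    using cos_one_sin_zero by (auto simp: chi_eq_cis complex_eq_iff)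
  also have "\<dots> \<longleftrightarrow> (\<exists>m::int. 2 * pi * of_int a / of_nat d = of_int m * 2 * pi)"
    by (rule cos_one_2pi_int)
  also have "\<dots> \<longleftrightarrow> (\<exists>m::int. of_int a = (of_int (int d * m) :: real))"
    using assms by (simp add: field_simps)
  also have "\<dots> \<longleftrightarrow> int d dvd a"
    unfolding of_int_eq_iff dvd_def ..
  finally show ?thesis .
qed

lemma chi_cong:
  assumes "d > 0" "[a = b] (mod int d)"
  shows "chi d a = chi d b"
proof -
  have "chi d (a - b) = 1"
    using assms by (simp add: chi_eq_1_iff cong_iff_dvd_diff)
  then show ?thesis using chi_add[of d "a - b" b] by simp
qed

context qudits
begin

definition character :: "(nat \<Rightarrow> int) \<Rightarrow> nat \<Rightarrow> complex" where
  "character p i = chi d (\<Sum>k<n. p k * dig d k i)"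

lemma norm_character [simp]: "cmod (character p i) = 1"
  by (simp add: character_def)

lemma character_enc: "character p (enc d n f) = chi d (\<Sum>k<n. p k * f k)"
  unfolding character_def by (intro chi_cong cong_sum cong_mult cong_refl dig_enc) auto

lemma character_unshift: "character p (unshift i q) = chi d (- (\<Sum>k<n. p k * q k)) * character p i"
  unfolding unshift_def character_enc
  by (simp add: character_def right_diff_distrib sum_subtractf flip: chi_add)

lemma character_lin_index:
  "character p (lin_index u v i j) = character (\<lambda>k. u * p k) i * character (\<lambda>k. v * p k) j"
  unfolding lin_index_def character_enc
  by (simp add: character_def algebra_simps sum.distrib flip: chi_add)

lemma character_add: "character (\<lambda>k. p k + p' k) i = character p i * character p' i"
  by (simp add: character_def ring_distribs sum.distrib chi_add)

lemma character_cong: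
  "(\<And>k. k < n \<Longrightarrow> [p k = p' k] (mod int d)) \<Longrightarrow> character p i = character p' i"
  unfolding character_def by (intro chi_cong cong_sum cong_mult cong_refl) auto

lemma bij_betw_digits_increment:
  assumes "l < n"
  shows "bij_betw (\<lambda>p. p(l := (p l + 1) mod int d)) (digits d n) (digits d n)"
  by (rule bij_betwI[where g = "\<lambda>p. p(l := (p l - 1) mod int d)"])
    (use assms in \<open>auto simp: digits_def mod_simps fun_eq_iff\<close>)

lemma character_increment:
  assumes "l < n"
  shows "character (p(l := (p l + 1) mod int d)) i = character p i * chi d (dig d l i)"
proof -
  have "character (p(l := (p l + 1) mod int d)) i
      = character (\<lambda>k. p k + (if k = l then 1 else 0)) i"
    by (rule character_cong) auto
  also have "\<dots> = character p i * chi d (dig d l i)"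
    unfolding character_add using assms
    by (simp add: character_def if_distrib[of "\<lambda>x. x * _"] cong: if_cong)
  finally show ?thesis .
qed

lemma character_orthogonal:
  assumes "r < D" "s < D"
  shows "(\<Sum>p\<in>digits d n. character p r * cnj (character p s)) = (if r = s then of_nat D else 0)"
proof (cases "r = s")
  case True
  then have "character p r * cnj (character p s) = 1" for p
    by (simp add: complex_norm_square[symmetric])
  then show ?thesis using True by (simp add: card_digits)
next
  case False
  then obtain l where l: "l < n" "[dig d l r \<noteq> dig d l s] (mod int d)"
    using index_eqI assms by blast
  let ?z = "chi d (dig d l r - dig d l s)"
  let ?product = "\<lambda>p. character p r * cnj (character p s)"
  have "(\<Sum>p\<in>digits d n. ?product p) = (\<Sum>p\<in>digits d n. ?product (p(l := (p l + 1) mod int d)))"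
    by (rule sum.reindex_bij_betw[OF bij_betw_digits_increment[OF l(1)], symmetric])
  also have "\<dots> = ?z * (\<Sum>p\<in>digits d n. ?product p)"
    unfolding character_increment[OF l(1)] sum_distrib_left
    using chi_add[of d "dig d l r" "- dig d l s"] by (simp add: chi_minus mult_ac)
  finally have "(1 - ?z) * (\<Sum>p\<in>digits d n. ?product p) = 0" by (simp add: algebra_simps)
  moreover have "?z \<noteq> 1"
    using l(2) by (simp add: chi_eq_1_iff cong_iff_dvd_diff)
  ultimately show ?thesis using False by simp
qed

lemma character_parseval:
  "(\<Sum>p\<in>digits d n. (cmod (\<Sum>r<D. f r * character p r))\<^sup>2) = real D * (\<Sum>r<D. (cmod (f r))\<^sup>2)"
proof -
  have "complex_of_real (\<Sum>p\<in>digits d n. (cmod (\<Sum>r<D. f r * character p r))\<^sup>2)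
      = (\<Sum>p\<in>digits d n. \<Sum>r<D. \<Sum>s<D. f r * cnj (f s) * (character p r * cnj (character p s)))"
    by (simp add: complex_norm_square sum_product mult_ac flip: of_real_power del: of_real_power)
  also have "\<dots> = (\<Sum>r<D. \<Sum>s<D. f r * cnj (f s)
      * (\<Sum>p\<in>digits d n. character p r * cnj (character p s)))"
    unfolding sum_distrib_left by (simp only: sum.swap[of _ _ "digits d n"])
  also have "\<dots> = (\<Sum>r<D. \<Sum>s<D. if r = s then f r * cnj (f r) * of_nat D else 0)"
    by (intro sum.cong refl) (auto simp: character_orthogonal)
  also have "\<dots> = of_real (real D * (\<Sum>r<D. (cmod (f r))\<^sup>2))"
    by (simp add: complex_norm_square[symmetric] sum_distrib_left mult_ac)
  finally show ?thesis using of_real_eq_iff by blast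
qed

text \<open>\<open>charfn M (p, q)\<close> is the trace of \<open>M Z\<^sup>p X\<^sup>q\<close>, that is, the characteristic function of
  \<open>M\<close> without the phase of the Weyl operator.\<close>

definition charfn :: "complex mat \<Rightarrow> label \<Rightarrow> complex" where
  "charfn M a = (\<Sum>r<D. M $$ (unshift r (snd a), r) * character (fst a) r)"

lemma charfn_parseval:
  "(\<Sum>a\<in>labels d n. (cmod (charfn M a))\<^sup>2) = real D * purity {..<D} (entries M)"
proof -
  have "(\<Sum>a\<in>labels d n. (cmod (charfn M a))\<^sup>2)
      = (\<Sum>p\<in>digits d n. \<Sum>q\<in>digits d n. (cmod (\<Sum>r<D. M $$ (unshift r q, r) * character p r))\<^sup>2)"
    by (simp add: labels_eq_Times sum.cartesian_product charfn_def case_prod_unfold)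
  also have "\<dots> = (\<Sum>q\<in>digits d n. real D * (\<Sum>r<D. (cmod (M $$ (unshift r q, r)))\<^sup>2))"
    by (subst sum.swap) (simp only: character_parseval)
  also have "\<dots> = real D * (\<Sum>r<D. \<Sum>q\<in>digits d n. (cmod (M $$ (unshift r q, r)))\<^sup>2)"
    unfolding sum_distrib_left by (rule sum.swap)
  also have "(\<Sum>r<D. \<Sum>q\<in>digits d n. (cmod (M $$ (unshift r q, r)))\<^sup>2)
      = (\<Sum>r<D. \<Sum>i<D. (cmod (M $$ (i, r)))\<^sup>2)"
    by (intro sum.cong refl sum.reindex_bij_betw bij_betw_unshift_digits)
  also have "\<dots> = purity {..<D} (entries M)"
    unfolding purity_def by (rule sum.swap)
  finally show ?thesis .
qed

end

section \<open>Weyl operators and stabilizer states\<close>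

lemma norm_weyl_phase: "cmod (weyl_phase d p q) = 1"
  by (simp add: weyl_phase_def norm_power_int)

lemma unit_vectors_parallel:
  fixes \<psi> \<phi> :: "'a \<Rightarrow> complex"
  assumes "finite I" "(\<Sum>r\<in>I. (cmod (\<psi> r))\<^sup>2) = 1" "(\<Sum>r\<in>I. (cmod (\<phi> r))\<^sup>2) = 1"
    and z: "z = (\<Sum>r\<in>I. \<phi> r * cnj (\<psi> r))" "cmod z = 1"
  shows "\<forall>r\<in>I. \<phi> r = z * \<psi> r"
proof -
  have cnj_z: "cnj z * z = 1" using z(2) complex_norm_square[of z] by (simp add: mult.commute)
  have "complex_of_real (\<Sum>r\<in>I. (cmod (\<phi> r - z * \<psi> r))\<^sup>2)
      = (\<Sum>r\<in>I. of_real ((cmod (\<phi> r))\<^sup>2) - cnj z * (\<phi> r * cnj (\<psi> r)) - z * cnj (\<phi> r * cnj (\<psi> r))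
          + (cnj z * z) * of_real ((cmod (\<psi> r))\<^sup>2))"
    unfolding of_real_sum complex_norm_square by (intro sum.cong) (auto simp: algebra_simps)
  also have "\<dots> = of_real (\<Sum>r\<in>I. (cmod (\<phi> r))\<^sup>2) - cnj z * z - z * cnj z
      + (cnj z * z) * of_real (\<Sum>r\<in>I. (cmod (\<psi> r))\<^sup>2)"
    unfolding sum.distrib sum_subtractf z(1) of_real_sum cnj_sum sum_distrib_left ..
  also have "\<dots> = 0" using assms(2,3) cnj_z by (simp add: mult.commute)
  finally have "(\<Sum>r\<in>I. (cmod (\<phi> r - z * \<psi> r))\<^sup>2) = 0" using of_real_eq_0_iff by blast
  then show ?thesis using assms(1) by (simp add: sum_nonneg_eq_0_iff)
qed

context qudits
begin

text \<open>\<open>zx (p, q)\<close> is \<open>Z\<^sup>p X\<^sup>q\<close>, a Weyl operator without its phase, on functions of the basis index.\<close>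

definition zx :: "label \<Rightarrow> (nat \<Rightarrow> complex) \<Rightarrow> nat \<Rightarrow> complex" where
  "zx a \<psi> r = character (fst a) r * \<psi> (unshift r (snd a))"

definition zx_eigen :: "(nat \<Rightarrow> complex) \<Rightarrow> label \<Rightarrow> complex \<Rightarrow> bool" where
  "zx_eigen \<psi> a c \<longleftrightarrow> (\<forall>r<D. zx a \<psi> r = c * \<psi> r)"

definition label_phase :: "label \<Rightarrow> complex" where
  "label_phase a = (\<Prod>k<n. weyl_phase d (fst a k) (snd a k))"

lemma label_phase_nonzero [simp]: "label_phase a \<noteq> 0"
proof -
  have "cmod (label_phase a) = 1"
    by (simp add: label_phase_def norm_weyl_phase flip: prod_norm)
  then show ?thesis by auto
qed

lemma zx_cong: "(\<And>r. r < D \<Longrightarrow> \<psi> r = \<phi> r) \<Longrightarrow> zx a \<psi> r = zx a \<phi> r"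
  by (simp add: zx_def)

lemma zx_scale: "zx a (\<lambda>r. c * \<psi> r) r = c * zx a \<psi> r"
  by (simp add: zx_def)

lemma zx_zx:
  "zx a (zx b \<psi>) r = chi d (- (\<Sum>k<n. fst b k * snd a k)) * zx (label_add d a b) \<psi> r"
proof -
  have "character (fst (label_add d a b)) r = character (fst a) r * character (fst b) r"
    unfolding character_add[symmetric] by (rule character_cong) (simp add: label_add_def)
  moreover have "unshift r (snd (label_add d a b)) = unshift (unshift r (snd a)) (snd b)"
    unfolding unshift_unshift by (rule unshift_cong) (simp add: label_add_def)
  ultimately show ?thesis by (simp add: zx_def character_unshift)
qed

lemma sum_norm_square_zx: "(\<Sum>r<D. (cmod (zx a \<psi> r))\<^sup>2) = (\<Sum>r<D. (cmod (\<psi> r))\<^sup>2)"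
  unfolding zx_def norm_mult norm_character mult_1_left
  by (rule sum.reindex_bij_betw[OF bij_betw_unshift])

lemma weyl1_eq_of_cong:
  assumes "[x = y + q] (mod int d)" "x mod int d = x"
  shows "weyl1 d p q x y = weyl_phase d p q * chi d (p * x)"
proof -
  have "chi d (p * (y + q)) = chi d (p * x)"
    by (intro chi_cong cong_mult cong_refl cong_sym[OF assms(1)]) simp
  then show ?thesis using assms by (simp add: weyl1_def cong_def)
qed

lemma weyl_entry:
  assumes "r < D" "c < D"
  shows "weyl d n a $$ (r, c) = label_phase a * zx a (\<lambda>i. of_bool (i = c)) r"
proof (cases "\<forall>k<n. [dig d k r = dig d k c + snd a k] (mod int d)")
  case True
  then have "unshift r (snd a) = c" using assms(2) by (simp add: unshift_eq_iff)
  moreover have "weyl1 d (fst a k) (snd a k) (dig d k r) (dig d k c)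
      = weyl_phase d (fst a k) (snd a k) * chi d (fst a k * dig d k r)" if "k < n" for k
    using True that by (intro weyl1_eq_of_cong) auto
  ultimately show ?thesis using assms
    by (simp add: weyl_def zx_def label_phase_def character_def chi_sum prod.distrib)
next
  case False
  then have "unshift r (snd a) \<noteq> c" using assms(2) by (simp add: unshift_eq_iff)
  moreover have "(\<Prod>k<n. weyl1 d (fst a k) (snd a k) (dig d k r) (dig d k c)) = 0"
    using False by (intro prod_zero) (auto simp: weyl1_def cong_def)
  ultimately show ?thesis using assms by (simp add: weyl_def zx_def)
qed

lemma weyl_row_sum:
  assumes "r < D"
  shows "(\<Sum>l<D. weyl d n a $$ (r, l) * \<psi> l) = label_phase a * zx a \<psi> r"
proof -
  have "(\<Sum>l<D. weyl d n a $$ (r, l) * \<psi> l)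
      = (\<Sum>l<D. if l = unshift r (snd a) then label_phase a * (character (fst a) r * \<psi> l) else 0)"
    using assms by (intro sum.cong) (auto simp: weyl_entry zx_def)
  then show ?thesis by (simp add: zx_def)
qed

lemma weyl_mult_entry:
  assumes "r < D" "c < D"
  shows "(weyl d n a * weyl d n b) $$ (r, c) =
    label_phase a * label_phase b * chi d (- (\<Sum>k<n. fst b k * snd a k))
      * zx (label_add d a b) (\<lambda>i. of_bool (i = c)) r"
proof -
  have "(weyl d n a * weyl d n b) $$ (r, c) = (\<Sum>l<D. weyl d n a $$ (r, l) * weyl d n b $$ (l, c))"
    using assms by (simp add: weyl_def scalar_prod_def atLeast0LessThan)
  also have "\<dots> = label_phase a * zx a (\<lambda>l. weyl d n b $$ (l, c)) r"
    by (rule weyl_row_sum[OF assms(1)])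
  also have "\<dots> = label_phase a * zx a (\<lambda>l. label_phase b * zx b (\<lambda>i. of_bool (i = c)) l) r"
    using assms(2) by (simp add: weyl_entry cong: zx_cong)
  finally show ?thesis by (simp add: zx_scale zx_zx mult_ac)
qed

lemma label_add_commute: "label_add d a b = label_add d b a"
  by (simp add: label_add_def add.commute)

lemma weyl_commute:
  assumes "chi d (\<Sum>k<n. fst b k * snd a k) = chi d (\<Sum>k<n. fst a k * snd b k)"
  shows "weyl d n a * weyl d n b = weyl d n b * weyl d n a"
proof (rule eq_matI)
  fix r c assume "r < dim_row (weyl d n b * weyl d n a)" "c < dim_col (weyl d n b * weyl d n a)"
  then have "r < D" "c < D" by (auto simp: weyl_def)
  then show "(weyl d n a * weyl d n b) $$ (r, c) = (weyl d n b * weyl d n a) $$ (r, c)"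
    using assms by (simp add: weyl_mult_entry chi_minus label_add_commute[of a b] mult_ac)
qed (auto simp: weyl_def)

lemma weyl_eigen_iff:
  assumes "\<psi> \<in> carrier_vec D"
  shows "(\<exists>c. weyl d n a *\<^sub>v \<psi> = c \<cdot>\<^sub>v \<psi>) \<longleftrightarrow> (\<exists>c. zx_eigen (($) \<psi>) a c)"
proof -
  have weyl_mult_vec: "(weyl d n a *\<^sub>v \<psi>) $ r = label_phase a * zx a (($) \<psi>) r" if "r < D" for r
    using assms that weyl_row_sum[OF that, of a "($) \<psi>"]
    by (simp add: weyl_def scalar_prod_def atLeast0LessThan)
  have "weyl d n a *\<^sub>v \<psi> = (label_phase a * c) \<cdot>\<^sub>v \<psi> \<longleftrightarrow> zx_eigen (($) \<psi>) a c" for c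
  proof -
    have "weyl d n a *\<^sub>v \<psi> = (label_phase a * c) \<cdot>\<^sub>v \<psi> \<longleftrightarrow>
        (\<forall>r<D. (weyl d n a *\<^sub>v \<psi>) $ r = ((label_phase a * c) \<cdot>\<^sub>v \<psi>) $ r)"
      using assms by (auto simp: vec_eq_iff weyl_def)
    then show ?thesis using assms by (simp add: weyl_mult_vec zx_eigen_def mult.assoc)
  qed
  moreover have "c = label_phase a * (c / label_phase a)" for c by simp
  ultimately show ?thesis by metis
qed

lemma zx_eigen_norm:
  assumes "(\<Sum>r<D. (cmod (\<psi> r))\<^sup>2) = 1" "zx_eigen \<psi> a c"
  shows "cmod c = 1"
proof -
  have "1 = (\<Sum>r<D. (cmod (zx a \<psi> r))\<^sup>2)"
    using assms(1) by (simp add: sum_norm_square_zx)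
  also have "\<dots> = (\<Sum>r<D. (cmod c)\<^sup>2 * (cmod (\<psi> r))\<^sup>2)"
    using assms(2) by (intro sum.cong) (auto simp: zx_eigen_def norm_mult power_mult_distrib)
  also have "\<dots> = (cmod c)\<^sup>2" using assms(1) by (simp flip: sum_distrib_left)
  finally show ?thesis using norm_ge_zero[of c] by (simp add: power2_eq_1_iff)
qed

lemma zx_eigen_label_add:
  assumes "zx_eigen \<psi> a ca" "zx_eigen \<psi> b cb"
  shows "zx_eigen \<psi> (label_add d a b) (chi d (\<Sum>k<n. fst b k * snd a k) * (ca * cb))"
  unfolding zx_eigen_def
proof (intro allI impI)
  fix r assume "r < D"
  let ?phase = "chi d (\<Sum>k<n. fst b k * snd a k)"
  have phase: "?phase * cnj ?phase = 1" by (simp flip: complex_norm_square)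
  have "zx a (zx b \<psi>) r = zx a (\<lambda>i. cb * \<psi> i) r"
    using assms(2) by (intro zx_cong) (simp add: zx_eigen_def)
  also have "\<dots> = ca * cb * \<psi> r"
    using assms(1) \<open>r < D\<close> by (simp add: zx_scale zx_eigen_def)
  finally have "cnj ?phase * zx (label_add d a b) \<psi> r = ca * cb * \<psi> r"
    by (simp add: zx_zx chi_minus)
  then have "?phase * cnj ?phase * zx (label_add d a b) \<psi> r = ?phase * (ca * cb) * \<psi> r"
    by (simp add: mult.assoc)
  then show "zx (label_add d a b) \<psi> r = ?phase * (ca * cb) * \<psi> r"
    by (simp add: phase)
qed

lemma zx_eigen_commute:
  assumes unit: "(\<Sum>r<D. (cmod (\<psi> r))\<^sup>2) = 1"
    and a: "zx_eigen \<psi> a ca" and b: "zx_eigen \<psi> b cb"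
  shows "weyl d n a * weyl d n b = weyl d n b * weyl d n a"
proof (rule weyl_commute)
  have "\<not> (\<forall>r<D. \<psi> r = 0)"
  proof
    assume "\<forall>r<D. \<psi> r = 0"
    then have "(\<Sum>r<D. (cmod (\<psi> r))\<^sup>2) = 0" by simp
    with unit show False by simp
  qed
  then obtain r where r: "r < D" "\<psi> r \<noteq> 0" by blast
  have "chi d (\<Sum>k<n. fst b k * snd a k) * (ca * cb) * \<psi> r
      = chi d (\<Sum>k<n. fst a k * snd b k) * (cb * ca) * \<psi> r"
    using zx_eigen_label_add[OF a b] zx_eigen_label_add[OF b a] r(1)
    by (simp add: zx_eigen_def label_add_commute[of a b])
  moreover have "ca \<noteq> 0" "cb \<noteq> 0"
    using zx_eigen_norm[OF unit a] zx_eigen_norm[OF unit b] by auto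
  ultimately show "chi d (\<Sum>k<n. fst b k * snd a k) = chi d (\<Sum>k<n. fst a k * snd b k)"
    using r(2) by simp
qed

lemma norm_charfn_proj_eq_1_iff:
  assumes unit: "(\<Sum>r<D. (cmod (\<psi> $ r))\<^sup>2) = 1"
  shows "cmod (charfn (proj_of D \<psi>) a) = 1 \<longleftrightarrow> (\<exists>c. zx_eigen (($) \<psi>) a c)"
proof -
  have charfn: "charfn (proj_of D \<psi>) a = (\<Sum>r<D. zx a (($) \<psi>) r * cnj (\<psi> $ r))"
    unfolding charfn_def zx_def by (intro sum.cong) (auto simp: proj_of_def)
  show ?thesis
  proof
    assume "cmod (charfn (proj_of D \<psi>) a) = 1"
    then have "\<forall>r\<in>{..<D}. zx a (($) \<psi>) r = charfn (proj_of D \<psi>) a * \<psi> $ r"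
      by (intro unit_vectors_parallel unit charfn) (simp_all add: sum_norm_square_zx unit)
    then show "\<exists>c. zx_eigen (($) \<psi>) a c" unfolding zx_eigen_def by blast
  next
    assume "\<exists>c. zx_eigen (($) \<psi>) a c"
    then obtain c where c: "zx_eigen (($) \<psi>) a c" ..
    have "charfn (proj_of D \<psi>) a = (\<Sum>r<D. c * of_real ((cmod (\<psi> $ r))\<^sup>2))"
      unfolding charfn using c
      by (intro sum.cong) (auto simp: zx_eigen_def complex_norm_square simp del: of_real_power)
    also have "\<dots> = c" using unit by (simp flip: sum_distrib_left of_real_sum of_real_power)
    finally show "cmod (charfn (proj_of D \<psi>) a) = 1" using zx_eigen_norm[OF unit c] by simp
  qed
qed

lemma norm_charfn_le_1:
  assumes "density_matrix D \<rho>"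
  shows "cmod (charfn \<rho> a) \<le> 1"
proof -
  have psd: "psd_kernel {..<D} (entries \<rho>)" and trace: "(\<Sum>i<D. \<rho> $$ (i, i)) = 1"
    using assms by (auto simp: density_matrix_iff_psd_kernel)
  define w where "w i = Re (\<rho> $$ (i, i))" for i
  have sum_w: "(\<Sum>i<D. w i) = 1" using trace by (simp add: w_def flip: Re_sum)
  have "cmod (charfn \<rho> a) \<le> (\<Sum>r<D. cmod (\<rho> $$ (unshift r (snd a), r)))"
    unfolding charfn_def by (rule order.trans[OF norm_sum]) (simp add: norm_mult)
  also have "\<dots> \<le> (\<Sum>r<D. (w (unshift r (snd a)) + w r) / 2)"
    unfolding w_def by (intro sum_mono psd_kernel_norm_le_mean[OF _ psd]) auto
  also have "\<dots> = ((\<Sum>r<D. w (unshift r (snd a))) + (\<Sum>r<D. w r)) / 2"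
    by (simp add: sum.distrib flip: sum_divide_distrib)
  also have "(\<Sum>r<D. w (unshift r (snd a))) = (\<Sum>r<D. w r)"
    by (rule sum.reindex_bij_betw[OF bij_betw_unshift])
  finally show ?thesis using sum_w by simp
qed

lemma sum_norm_square_charfn_le:
  assumes "density_matrix D \<rho>"
  shows "(\<Sum>a\<in>labels d n. (cmod (charfn \<rho> a))\<^sup>2) \<le> real D"
proof -
  have psd: "psd_kernel {..<D} (entries \<rho>)" and "(\<Sum>i<D. \<rho> $$ (i, i)) = 1"
    using assms by (auto simp: density_matrix_iff_psd_kernel)
  then have "(\<Sum>i<D. Re (\<rho> $$ (i, i))) = 1" by (simp flip: Re_sum)
  then have "purity {..<D} (entries \<rho>) \<le> 1"
    using psd_kernel_purity_le[OF _ psd] by simp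
  then show ?thesis unfolding charfn_parseval by (simp add: mult_left_le)
qed

lemma charfn_0:
  assumes "density_matrix D \<rho>"
  shows "charfn \<rho> ((\<lambda>k. 0), (\<lambda>k. 0)) = 1"
proof -
  have "charfn \<rho> ((\<lambda>k. 0), (\<lambda>k. 0)) = (\<Sum>r<D. \<rho> $$ (r, r))"
    unfolding charfn_def by (intro sum.cong) (auto simp: unshift_0 character_def)
  then show ?thesis using assms by (simp add: density_matrix_iff_psd_kernel)
qed

lemma stabilizer_state_norm_charfn:
  assumes "is_pure_stabilizer_state d n \<rho> S" "a \<in> S"
  shows "cmod (charfn \<rho> a) = 1"
proof -
  from assms obtain \<psi> where \<psi>: "\<psi> \<in> carrier_vec D" "(\<Sum>i<D. (cmod (\<psi> $ i))\<^sup>2) = 1"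
    and \<rho>: "\<rho> = proj_of D \<psi>" and eigen: "\<exists>c. weyl d n a *\<^sub>v \<psi> = c \<cdot>\<^sub>v \<psi>"
    unfolding is_pure_stabilizer_state_def by blast
  show ?thesis
    using eigen unfolding \<rho> weyl_eigen_iff[OF \<psi>(1)] norm_charfn_proj_eq_1_iff[OF \<psi>(2)] .
qed

lemma stabilizer_stateI:
  assumes dens: "density_matrix D \<rho>" and pure: "purity {..<D} (entries \<rho>) = 1"
    and card: "card {a \<in> labels d n. cmod (charfn \<rho> a) = 1} = D" (is "card ?S = D")
  shows "is_pure_stabilizer_state d n \<rho> ?S"
proof -
  obtain \<psi> where \<psi>: "\<psi> \<in> carrier_vec D" "(\<Sum>i<D. (cmod (\<psi> $ i))\<^sup>2) = 1" and \<rho>: "\<rho> = proj_of D \<psi>"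
    using density_matrix_pure[OF dens pure] .
  have S: "?S = {a \<in> labels d n. \<exists>c. zx_eigen (($) \<psi>) a c}"
    unfolding \<rho> norm_charfn_proj_eq_1_iff[OF \<psi>(2)] ..
  have zero: "((\<lambda>k. 0), (\<lambda>k. 0)) \<in> ?S"
    using charfn_0[OF dens] by (simp add: labels_def)
  have add: "label_add d a b \<in> ?S" if "a \<in> ?S" "b \<in> ?S" for a b
  proof -
    have "label_add d a b \<in> labels d n"
      using that by (auto simp: label_add_def labels_def)
    then show ?thesis using that zx_eigen_label_add unfolding S by blast
  qed
  have comm: "weyl d n a * weyl d n b = weyl d n b * weyl d n a" if "a \<in> ?S" "b \<in> ?S" for a b
    using that zx_eigen_commute[OF \<psi>(2)] unfolding S by blast
  have eigen: "\<exists>c. weyl d n a *\<^sub>v \<psi> = c \<cdot>\<^sub>v \<psi>" if "a \<in> ?S" for a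
    using that unfolding S weyl_eigen_iff[OF \<psi>(1)] by blast
  show ?thesis
    unfolding is_pure_stabilizer_state_def
    by (intro conjI ballI exI[of _ \<psi>] Collect_restrict card zero add comm \<psi> \<rho> eigen)
qed

text \<open>The stabilizer labels already exhaust the Parseval budget \<open>d\<^sup>n\<close>, so \<open>|charfn \<rho>|\<close> vanishes
  at all other labels.\<close>

lemma stabilizer_state_iff_charfn:
  assumes dens: "density_matrix D \<rho>" and S: "S \<subseteq> labels d n"
  shows "is_pure_stabilizer_state d n \<rho> S \<longleftrightarrow>
    card S = D \<and> (\<forall>a\<in>labels d n. cmod (charfn \<rho> a) = of_bool (a \<in> S))"
proof
  assume stab: "is_pure_stabilizer_state d n \<rho> S"
  then have card: "card S = D" by (simp add: is_pure_stabilizer_state_def)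
  have "(\<Sum>a\<in>S. (cmod (charfn \<rho> a))\<^sup>2) = real D"
    using stabilizer_state_norm_charfn[OF stab] card by simp
  then have "(\<Sum>a\<in>labels d n - S. (cmod (charfn \<rho> a))\<^sup>2) \<le> 0"
    using sum_norm_square_charfn_le[OF dens] S by (simp add: sum_diff)
  then have "(\<Sum>a\<in>labels d n - S. (cmod (charfn \<rho> a))\<^sup>2) = 0"
    by (intro order.antisym sum_nonneg) auto
  then have "cmod (charfn \<rho> a) = 0" if "a \<in> labels d n" "a \<notin> S" for a
    using that by (simp add: sum_nonneg_eq_0_iff)
  then show "card S = D \<and> (\<forall>a\<in>labels d n. cmod (charfn \<rho> a) = of_bool (a \<in> S))"
    using card stabilizer_state_norm_charfn[OF stab] by simp
next
  assume charfn: "card S = D \<and> (\<forall>a\<in>labels d n. cmod (charfn \<rho> a) = of_bool (a \<in> S))"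
  then have support: "{a \<in> labels d n. cmod (charfn \<rho> a) = 1} = S"
    using S by auto
  have "real D * purity {..<D} (entries \<rho>) = (\<Sum>a\<in>labels d n. (cmod (charfn \<rho> a))\<^sup>2)"
    by (rule charfn_parseval[symmetric])
  also have "\<dots> = (\<Sum>a\<in>labels d n. of_bool (a \<in> S))"
    using charfn by (intro sum.cong) auto
  also have "\<dots> = real D"
    using charfn S by (simp add: of_bool_def sum.If_cases Int_absorb1)
  finally have "purity {..<D} (entries \<rho>) = 1" by simp
  then show "is_pure_stabilizer_state d n \<rho> S"
    using stabilizer_stateI[OF dens] charfn unfolding support by blast
qed

end

section \<open>Convolution\<close>

lemma permutation_mat_conj_entry:
  fixes K :: "complex mat"
  assumes inj: "inj_on \<pi> {..<m}" and range: "\<pi> ` {..<m} \<subseteq> {..<m}"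
    and K: "K \<in> carrier_mat m m" and "i < m" "j < m"
  defines "P \<equiv> mat m m (\<lambda>(r, c). if r = \<pi> c then 1 else 0)"
  shows "(P * K * adj P) $$ (\<pi> i, \<pi> j) = K $$ (i, j)"
proof -
  have P: "P \<in> carrier_mat m m" by (simp add: P_def)
  have \<pi>_less: "\<pi> l < m" if "l < m" for l using range that by auto
  have entry: "P $$ (\<pi> l, c) = (if c = l then 1 else 0)" if "l < m" "c < m" for l c
    using that \<pi>_less inj_on_eq_iff[OF inj, of l c] by (auto simp: P_def)
  have PK: "(P * K) $$ (\<pi> i, c) = K $$ (i, c)" if "c < m" for c
  proof -
    have "(P * K) $$ (\<pi> i, c) = (\<Sum>l<m. P $$ (\<pi> i, l) * K $$ (l, c))"
      using P K \<pi>_less \<open>i < m\<close> that by (simp add: scalar_prod_def atLeast0LessThan)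
    also have "\<dots> = (\<Sum>l<m. if l = i then K $$ (l, c) else 0)"
      using \<open>i < m\<close> by (intro sum.cong) (auto simp: entry)
    finally show ?thesis using \<open>i < m\<close> by simp
  qed
  have "(P * K * adj P) $$ (\<pi> i, \<pi> j) = (\<Sum>c<m. (P * K) $$ (\<pi> i, c) * adj P $$ (c, \<pi> j))"
    using P K \<pi>_less \<open>i < m\<close> \<open>j < m\<close> by (simp add: scalar_prod_def atLeast0LessThan adj_def)
  also have "\<dots> = (\<Sum>c<m. if c = j then K $$ (i, c) else 0)"
    using P \<pi>_less \<open>j < m\<close> by (intro sum.cong) (auto simp: PK adj_def entry)
  finally show ?thesis using \<open>j < m\<close> by simp
qed

lemma index_mult_add_less:
  fixes a b D :: nat
  assumes "a < D" "b < D"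
  shows "a * D + b < D * D"
proof -
  have "a * D + b < Suc a * D" using assms(2) by simp
  also have "\<dots> \<le> D * D" using assms(1) by (intro mult_right_mono) auto
  finally show ?thesis .
qed

lemma kron_entry:
  assumes "A \<in> carrier_mat D D" "B \<in> carrier_mat D D" "x < D" "y < D" "x' < D" "y' < D"
  shows "kron A B $$ (x * D + y, x' * D + y') = A $$ (x, x') * B $$ (y, y')"
  using assms index_mult_add_less[of x D y] index_mult_add_less[of x' D y'] by (simp add: kron_def)

context qudits
begin

definition scale_label :: "int \<Rightarrow> int \<Rightarrow> label \<Rightarrow> label" where
  "scale_label u v a = ((\<lambda>k. (u * fst a k) mod int d), (\<lambda>k. (v * snd a k) mod int d))"

lemma scale_label_in_labels: "a \<in> labels d n \<Longrightarrow> scale_label u v a \<in> labels d n"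
  by (auto simp: labels_def scale_label_def)

lemma scale_label_cong:
  assumes "[u = u'] (mod int d)" "[v = v'] (mod int d)"
  shows "scale_label u v a = scale_label u' v' a"
  using cong_mult[OF assms(1) cong_refl] cong_mult[OF assms(2) cong_refl]
  by (simp add: scale_label_def cong_def)

lemma scale_label_scale_label:
  "scale_label u v (scale_label u' v' a) = scale_label (u * u') (v * v') a"
  by (simp add: scale_label_def mod_mult_right_eq mult.assoc)

lemma scale_label_eq_self:
  assumes "[u = 1] (mod int d)" "[v = 1] (mod int d)" "a \<in> labels d n"
  shows "scale_label u v a = a"
proof -
  have "scale_label u v a = scale_label 1 1 a" by (rule scale_label_cong[OF assms(1,2)])
  moreover have "fst a k mod int d = fst a k" "snd a k mod int d = snd a k" for k
    using assms(3) by (simp_all add: labels_eq_Times mem_Times_iff digits_mod[of _ d n])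
  ultimately show ?thesis by (simp add: scale_label_def)
qed

lemma bij_betw_scale_label:
  assumes "coprime u (int d)" "coprime v (int d)"
  shows "bij_betw (scale_label u v) (labels d n) (labels d n)"
proof (rule bij_betwI)
  let ?inverse = "scale_label (modular_inverse (int d) u) (modular_inverse (int d) v)"
  show "?inverse (scale_label u v a) = a" "scale_label u v (?inverse a) = a"
    if "a \<in> labels d n" for a
    using that cong_modular_inverse1[OF assms(1)] cong_modular_inverse2[OF assms(1)]
      cong_modular_inverse1[OF assms(2)] cong_modular_inverse2[OF assms(2)]
    by (simp_all add: scale_label_scale_label scale_label_eq_self)
qed (auto intro: scale_label_in_labels)

lemma charfn_scale_label:
  "charfn M (scale_label u v a) = charfn M (\<lambda>k. u * fst a k, \<lambda>k. v * snd a k)"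
proof -
  have "character (fst (scale_label u v a)) r = character (\<lambda>k. u * fst a k) r"
    "unshift r (snd (scale_label u v a)) = unshift r (\<lambda>k. v * snd a k)" for r
    by (auto simp: scale_label_def intro: character_cong unshift_cong)
  then show ?thesis by (simp add: charfn_def)
qed

end

locale qudit_convolution = qudits +
  fixes g00 g01 g10 g11 :: int
  assumes coprime_entries: "coprime g00 (int d)" "coprime g01 (int d)"
      "coprime g10 (int d)" "coprime g11 (int d)"
    and coprime_det: "coprime (g00 * g11 - g01 * g10) (int d)"
begin

definition N :: int where "N = modular_inverse (int d) (g00 * g11 - g01 * g10)"

text \<open>The key unitary maps \<open>|x\<rangle>|y\<rangle>\<close> to \<open>|U_fst x y\<rangle>|U_snd x y\<rangle>\<close>.\<close>

abbreviation U_fst :: "nat \<Rightarrow> nat \<Rightarrow> nat" where "U_fst \<equiv> lin_index (N * g11) (- (N * g10))"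
abbreviation U_snd :: "nat \<Rightarrow> nat \<Rightarrow> nat" where "U_snd \<equiv> lin_index (- (N * g01)) (N * g00)"
abbreviation U_inv_fst :: "nat \<Rightarrow> nat \<Rightarrow> nat" where "U_inv_fst \<equiv> lin_index g00 g10"
abbreviation U_inv_snd :: "nat \<Rightarrow> nat \<Rightarrow> nat" where "U_inv_snd \<equiv> lin_index g01 g11"

abbreviation conv :: "complex mat \<Rightarrow> complex mat \<Rightarrow> complex mat"  (infixl "\<star>" 70) where
  "\<rho> \<star> \<sigma> \<equiv> qconv d n g00 g01 g10 g11 \<rho> \<sigma>"

abbreviation stab :: "label \<Rightarrow> label" where "stab \<equiv> stab_map d g00 g01 g10 g11"

lemma N_det: "[N * (g00 * g11 - g10 * g01) = 1] (mod int d)"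
  using cong_modular_inverse2[OF coprime_det] by (simp add: N_def mult.commute)

lemmas U_inverse = lin_index_adjugate[OF N_det]

lemma sum_U_inv:
  "(\<Sum>a<D. \<Sum>b<D. f (U_inv_fst a b) (U_inv_snd a b)) = (\<Sum>x<D. \<Sum>y<D. f x y)"
proof -
  have "bij_betw (\<lambda>(a, b). (U_inv_fst a b, U_inv_snd a b)) ({..<D} \<times> {..<D}) ({..<D} \<times> {..<D})"
    by (rule bij_betwI[where g = "\<lambda>(x, y). (U_fst x y, U_snd x y)"]) (auto simp: U_inverse)
  from sum.reindex_bij_betw[OF this, of "\<lambda>(x, y). f x y"] show ?thesis
    by (simp add: sum.cartesian_product case_prod_unfold)
qed

lemma U_map_eq:
  "U_map d n g00 g01 g10 g11 c = U_fst (c div D) (c mod D) * D + U_snd (c div D) (c mod D)"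
  by (simp add: U_map_def lin_index_def N_def Let_def)

lemma U_map_inverse:
  assumes "a < D" "b < D"
  shows "U_map d n g00 g01 g10 g11 (U_inv_fst a b * D + U_inv_snd a b) = a * D + b"
  using assms by (simp add: U_map_eq U_inverse)

lemma U_map_range: "U_map d n g00 g01 g10 g11 ` {..<D * D} \<subseteq> {..<D * D}"
  by (auto simp: U_map_eq index_mult_add_less)

lemma inj_on_U_map: "inj_on (U_map d n g00 g01 g10 g11) {..<D * D}"
proof (rule inj_on_inverseI)
  fix c assume "c \<in> {..<D * D}"
  then have "c div D < D" "c mod D < D" by (simp_all add: less_mult_imp_div_less)
  then show "(\<lambda>e. U_inv_fst (e div D) (e mod D) * D + U_inv_snd (e div D) (e mod D))
      (U_map d n g00 g01 g10 g11 c) = c"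
    by (simp add: U_map_eq U_inverse div_mult_mod_eq)
qed

lemma conv_carrier [simp]: "\<rho> \<star> \<sigma> \<in> carrier_mat D D"
  by (simp add: qconv_def ptrace_B_def Let_def)

lemma conv_entry:
  assumes "\<rho> \<in> carrier_mat D D" "\<sigma> \<in> carrier_mat D D" "a < D" "a' < D"
  shows "(\<rho> \<star> \<sigma>) $$ (a, a') =
    (\<Sum>b<D. \<rho> $$ (U_inv_fst a b, U_inv_fst a' b) * \<sigma> $$ (U_inv_snd a b, U_inv_snd a' b))"
proof -
  let ?U = "U_mat d n g00 g01 g10 g11"
  have kron: "kron \<rho> \<sigma> \<in> carrier_mat (D * D) (D * D)" using assms by (simp add: kron_def)
  have conj: "(?U * kron \<rho> \<sigma> * adj ?U) $$ (a * D + b, a' * D + b) =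
      \<rho> $$ (U_inv_fst a b, U_inv_fst a' b) * \<sigma> $$ (U_inv_snd a b, U_inv_snd a' b)" if "b < D" for b
  proof -
    let ?i = "U_inv_fst a b * D + U_inv_snd a b" and ?j = "U_inv_fst a' b * D + U_inv_snd a' b"
    have "(?U * kron \<rho> \<sigma> * adj ?U) $$ (a * D + b, a' * D + b) = kron \<rho> \<sigma> $$ (?i, ?j)"
      using permutation_mat_conj_entry[OF inj_on_U_map U_map_range kron, of ?i ?j] assms(3,4) that
      by (simp add: U_mat_def U_map_inverse index_mult_add_less)
    then show ?thesis using assms(1,2) by (simp add: kron_entry)
  qed
  have "(\<rho> \<star> \<sigma>) $$ (a, a') = (\<Sum>b<D. (?U * kron \<rho> \<sigma> * adj ?U) $$ (a * D + b, a' * D + b))"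
    using assms(3,4) by (simp add: qconv_def ptrace_B_def Let_def)
  then show ?thesis by (simp add: conj)
qed

text \<open>Entrywise, the convolution is a sum over \<open>b\<close> of Schur products of reindexed copies of the
  two factors.\<close>

lemma density_matrix_conv:
  assumes "density_matrix D \<rho>" "density_matrix D \<sigma>"
  shows "density_matrix D (\<rho> \<star> \<sigma>)"
proof -
  have \<rho>: "\<rho> \<in> carrier_mat D D" "psd_kernel {..<D} (entries \<rho>)" "(\<Sum>i<D. \<rho> $$ (i, i)) = 1"
    and \<sigma>: "\<sigma> \<in> carrier_mat D D" "psd_kernel {..<D} (entries \<sigma>)" "(\<Sum>i<D. \<sigma> $$ (i, i)) = 1"
    using assms unfolding density_matrix_iff_psd_kernel by blast+
  have "psd_kernel {..<D} (\<lambda>a a'. \<Sum>b<D.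
      \<rho> $$ (U_inv_fst a b, U_inv_fst a' b) * \<sigma> $$ (U_inv_snd a b, U_inv_snd a' b))"
    by (intro psd_kernel_sum psd_kernel_mult finite_lessThan
        psd_kernel_compose[OF _ _ \<rho>(2)] psd_kernel_compose[OF _ _ \<sigma>(2)]) auto
  then have "psd_kernel {..<D} (entries (\<rho> \<star> \<sigma>))"
    by (subst psd_kernel_cong) (simp_all add: conv_entry[OF \<rho>(1) \<sigma>(1)])
  moreover have "(\<Sum>a<D. (\<rho> \<star> \<sigma>) $$ (a, a)) = 1"
  proof -
    have "(\<Sum>a<D. (\<rho> \<star> \<sigma>) $$ (a, a)) = (\<Sum>a<D. \<Sum>b<D.
        \<rho> $$ (U_inv_fst a b, U_inv_fst a b) * \<sigma> $$ (U_inv_snd a b, U_inv_snd a b))"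
      by (simp add: conv_entry[OF \<rho>(1) \<sigma>(1)])
    also have "\<dots> = (\<Sum>x<D. \<Sum>y<D. \<rho> $$ (x, x) * \<sigma> $$ (y, y))"
      by (rule sum_U_inv)
    finally show ?thesis by (simp add: \<rho>(3) \<sigma>(3) flip: sum_product)
  qed
  ultimately show ?thesis unfolding density_matrix_iff_psd_kernel by simp
qed

text \<open>\<open>U\<close> conjugates \<open>Z\<^sup>p X\<^sup>q \<otimes> I\<close> into a tensor product of Weyl operators.\<close>

lemma charfn_conv:
  assumes "\<rho> \<in> carrier_mat D D" "\<sigma> \<in> carrier_mat D D"
  shows "charfn (\<rho> \<star> \<sigma>) a =
    charfn \<rho> (scale_label (N * g11) g00 a) * charfn \<sigma> (scale_label (- (N * g10)) g01 a)"
proof -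
  let ?p = "fst a" and ?q = "snd a"
  define R where
    "R x = \<rho> $$ (unshift x (\<lambda>k. g00 * ?q k), x) * character (\<lambda>k. N * g11 * ?p k) x" for x
  define S where
    "S y = \<sigma> $$ (unshift y (\<lambda>k. g01 * ?q k), y) * character (\<lambda>k. - (N * g10) * ?p k) y" for y
  have "(\<rho> \<star> \<sigma>) $$ (unshift r ?q, r) * character ?p r
      = (\<Sum>b<D. R (U_inv_fst r b) * S (U_inv_snd r b))"
    if "r < D" for r
  proof -
    have "character ?p r = character (\<lambda>k. N * g11 * ?p k) (U_inv_fst r b)
        * character (\<lambda>k. - (N * g10) * ?p k) (U_inv_snd r b)" if "b < D" for b
      using character_lin_index[of ?p "N * g11" "- (N * g10)" "U_inv_fst r b" "U_inv_snd r b"]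
        \<open>r < D\<close> that by (simp only: U_inverse(1))
    then have "\<rho> $$ (U_inv_fst (unshift r ?q) b, U_inv_fst r b)
        * \<sigma> $$ (U_inv_snd (unshift r ?q) b, U_inv_snd r b) * character ?p r
        = R (U_inv_fst r b) * S (U_inv_snd r b)" if "b < D" for b
      using that by (simp add: lin_index_unshift R_def S_def)
    then show ?thesis
      using that by (simp add: conv_entry[OF assms] sum_distrib_right)
  qed
  then have "charfn (\<rho> \<star> \<sigma>) a = (\<Sum>r<D. \<Sum>b<D. R (U_inv_fst r b) * S (U_inv_snd r b))"
    by (simp add: charfn_def)
  also have "\<dots> = (\<Sum>x<D. \<Sum>y<D. R x * S y)" by (rule sum_U_inv)
  also have "\<dots> = (\<Sum>x<D. R x) * (\<Sum>y<D. S y)" by (rule sum_product[symmetric])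
  finally show ?thesis unfolding charfn_scale_label by (simp add: charfn_def R_def S_def)
qed

lemma stab_map_eq_scale_label:
  "stab = scale_label (- modular_inverse (int d) g10 * g11) (modular_inverse (int d) g01 * g00)"
  by (simp add: stab_map_def scale_label_def fun_eq_iff)

lemma bij_betw_stab_map: "bij_betw stab (labels d n) (labels d n)"
  unfolding stab_map_eq_scale_label by (rule bij_betw_scale_label) (simp_all add: coprime_entries)

lemma stab_map_scale_label: "stab (scale_label (- (N * g10)) g01 a) = scale_label (N * g11) g00 a"
proof -
  let ?inv = "modular_inverse (int d)"
  have "[?inv g10 * g10 * (N * g11) = 1 * (N * g11)] (mod int d)"
    "[?inv g01 * g01 * g00 = 1 * g00] (mod int d)"
    by (intro cong_mult cong_refl cong_modular_inverse2 coprime_entries)+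
  then show ?thesis
    unfolding stab_map_eq_scale_label scale_label_scale_label
    by (intro scale_label_cong) (simp_all add: mult_ac)
qed

lemma vN_entropy_conv_eq_0_iff_charfn:
  assumes "density_matrix D \<rho>" "density_matrix D \<sigma>"
  shows "vN_entropy (\<rho> \<star> \<sigma>) = 0 \<longleftrightarrow>
    (\<Sum>b\<in>labels d n. (cmod (charfn \<rho> (stab b)))\<^sup>2 * (cmod (charfn \<sigma> b))\<^sup>2) = real D"
proof -
  let ?h = "\<lambda>b. (cmod (charfn \<rho> (stab b)))\<^sup>2 * (cmod (charfn \<sigma> b))\<^sup>2"
  have carrier: "\<rho> \<in> carrier_mat D D" "\<sigma> \<in> carrier_mat D D"
    using assms by (auto simp: density_matrix_def)
  have "coprime (- (N * g10)) (int d)"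
    by (simp add: N_def coprime_det coprime_entries)
  then have bij: "bij_betw (scale_label (- (N * g10)) g01) (labels d n) (labels d n)"
    by (rule bij_betw_scale_label) (rule coprime_entries)
  have "real D * purity {..<D} (entries (\<rho> \<star> \<sigma>)) = (\<Sum>a\<in>labels d n. (cmod (charfn (\<rho> \<star> \<sigma>) a))\<^sup>2)"
    by (rule charfn_parseval[symmetric])
  also have "\<dots> = (\<Sum>a\<in>labels d n. ?h (scale_label (- (N * g10)) g01 a))"
    unfolding charfn_conv[OF carrier] stab_map_scale_label
    by (simp only: norm_mult power_mult_distrib)
  also have "\<dots> = (\<Sum>b\<in>labels d n. ?h b)"
    by (rule sum.reindex_bij_betw[OF bij])
  finally have total: "real D * purity {..<D} (entries (\<rho> \<star> \<sigma>)) = (\<Sum>b\<in>labels d n. ?h b)" .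
  show ?thesis
    unfolding vN_entropy_eq_0_iff_purity[OF density_matrix_conv[OF assms]] total[symmetric] by simp
qed

lemma stabilizer_state_stab_map_iff:
  assumes "density_matrix D \<rho>" "S \<subseteq> labels d n"
  shows "is_pure_stabilizer_state d n \<rho> (stab ` S) \<longleftrightarrow>
    card S = D \<and> (\<forall>b\<in>labels d n. cmod (charfn \<rho> (stab b)) = of_bool (b \<in> S))"
proof -
  have inj: "inj_on stab (labels d n)" and image: "stab ` labels d n = labels d n"
    using bij_betw_stab_map by (simp_all add: bij_betw_def)
  have "stab ` S \<subseteq> labels d n" using assms(2) image by blast
  then have "is_pure_stabilizer_state d n \<rho> (stab ` S) \<longleftrightarrow>
      card (stab ` S) = D \<and> (\<forall>a\<in>stab ` labels d n. cmod (charfn \<rho> a) = of_bool (a \<in> stab ` S))"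
    unfolding image by (rule stabilizer_state_iff_charfn[OF assms(1)])
  then show ?thesis
    using inj_on_image_mem_iff[OF inj _ assms(2)] card_image[OF inj_on_subset[OF inj assms(2)]]
    by simp
qed

end

lemma sum_mult_eq_iff_of_bool:
  fixes f g :: "'a \<Rightarrow> real"
  assumes fin: "finite A" and bounds: "\<And>x. x \<in> A \<Longrightarrow> f x \<in> {0..1} \<and> g x \<in> {0..1}"
    and sums: "sum f A \<le> c" "sum g A \<le> c"
  shows "(\<Sum>x\<in>A. f x * g x) = c \<longleftrightarrow>
    (\<exists>S\<subseteq>A. real (card S) = c \<and> (\<forall>x\<in>A. f x = of_bool (x \<in> S)) \<and> (\<forall>x\<in>A. g x = of_bool (x \<in> S)))"
    (is "_ \<longleftrightarrow> ?indicators")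
proof
  assume total: "(\<Sum>x\<in>A. f x * g x) = c"
  have gap_nonneg: "0 \<le> f x - f x * g x" "0 \<le> g x - f x * g x" if "x \<in> A" for x
    using bounds[OF that] by (simp_all add: mult_left_le mult_left_le_one_le)
  then have "0 \<le> (\<Sum>x\<in>A. f x - f x * g x)" "0 \<le> (\<Sum>x\<in>A. g x - f x * g x)"
    by (simp_all add: sum_nonneg)
  then have "(\<Sum>x\<in>A. f x - f x * g x) = 0" "(\<Sum>x\<in>A. g x - f x * g x) = 0"
    using sums total by (simp_all add: sum_subtractf)
  then have "f x - f x * g x = 0" "g x - f x * g x = 0" if "x \<in> A" for x
    using that gap_nonneg fin by (simp_all add: sum_nonneg_eq_0_iff)
  then have "(f x = 0 \<or> g x = 1) \<and> (g x = 0 \<or> f x = 1)" if "x \<in> A" for x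
    using that by fastforce
  then have zero_one: "g x = f x" "f x = 0 \<or> f x = 1" if "x \<in> A" for x
    using that by fastforce+
  define S where "S = {x \<in> A. f x = 1}"
  have indicator: "f x = of_bool (x \<in> S)" "g x = of_bool (x \<in> S)" if "x \<in> A" for x
    using zero_one[OF that] that by (auto simp: S_def)
  have "real (card S) = (\<Sum>x\<in>A. of_bool (x \<in> S))"
    using fin by (simp add: S_def of_bool_def sum.If_cases Int_def)
  also have "\<dots> = (\<Sum>x\<in>A. f x * g x)"
    by (intro sum.cong) (auto simp: indicator)
  finally have "real (card S) = c" using total by simp
  then show ?indicators
    using indicator by (intro exI[of _ S]) (simp add: S_def)
next
  assume ?indicators
  then obtain S where S: "S \<subseteq> A" "real (card S) = c"
    and "\<forall>x\<in>A. f x = of_bool (x \<in> S)" "\<forall>x\<in>A. g x = of_bool (x \<in> S)" by blast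
  then have "(\<Sum>x\<in>A. f x * g x) = (\<Sum>x\<in>A. of_bool (x \<in> S))"
    by (intro sum.cong) auto
  then show "(\<Sum>x\<in>A. f x * g x) = c"
    using S fin by (simp add: of_bool_def sum.If_cases Int_absorb1)
qed

lemma square_eq_of_bool_iff:
  fixes x :: real
  assumes "0 \<le> x"
  shows "x\<^sup>2 = of_bool P \<longleftrightarrow> x = of_bool P"
  using assms power2_eq_iff_nonneg[of x 1] by (cases P) auto

theorem (in qudit_convolution) vN_entropy_conv_eq_0_iff_stabilizer_states:
  assumes \<rho>: "density_matrix D \<rho>" and \<sigma>: "density_matrix D \<sigma>"
  shows "vN_entropy (\<rho> \<star> \<sigma>) = 0 \<longleftrightarrow>
    (\<exists>S1 S2. is_pure_stabilizer_state d n \<rho> S1 \<and> is_pure_stabilizer_state d n \<sigma> S2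
       \<and> S1 = stab ` S2)"
proof -
  define f where "f b = (cmod (charfn \<rho> (stab b)))\<^sup>2" for b
  define g where "g b = (cmod (charfn \<sigma> b))\<^sup>2" for b
  have bounds: "f b \<in> {0..1} \<and> g b \<in> {0..1}" for b
    using norm_charfn_le_1[OF \<rho>, of "stab b"] norm_charfn_le_1[OF \<sigma>, of b]
    by (simp add: f_def g_def power_le_one)
  have "sum f (labels d n) = (\<Sum>a\<in>labels d n. (cmod (charfn \<rho> a))\<^sup>2)"
    unfolding f_def by (rule sum.reindex_bij_betw[OF bij_betw_stab_map])
  then have sums: "sum f (labels d n) \<le> real D" "sum g (labels d n) \<le> real D"
    using sum_norm_square_charfn_le[OF \<rho>] sum_norm_square_charfn_le[OF \<sigma>] by (simp_all add: g_def)
  have states: "is_pure_stabilizer_state d n \<rho> (stab ` S) \<and> is_pure_stabilizer_state d n \<sigma> S \<longleftrightarrow>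
      card S = D \<and> (\<forall>b\<in>labels d n. f b = of_bool (b \<in> S)) \<and> (\<forall>b\<in>labels d n. g b = of_bool (b \<in> S))"
    if "S \<subseteq> labels d n" for S
    unfolding stabilizer_state_stab_map_iff[OF \<rho> that] stabilizer_state_iff_charfn[OF \<sigma> that]
    by (simp only: f_def g_def square_eq_of_bool_iff norm_ge_zero) blast
  have "vN_entropy (\<rho> \<star> \<sigma>) = 0 \<longleftrightarrow> (\<Sum>b\<in>labels d n. f b * g b) = real D"
    unfolding f_def g_def by (rule vN_entropy_conv_eq_0_iff_charfn[OF \<rho> \<sigma>])
  also have "\<dots> \<longleftrightarrow> (\<exists>S\<subseteq>labels d n. card S = D \<and>
      (\<forall>b\<in>labels d n. f b = of_bool (b \<in> S)) \<and> (\<forall>b\<in>labels d n. g b = of_bool (b \<in> S)))"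
    unfolding sum_mult_eq_iff_of_bool[OF finite_labels bounds sums] of_nat_eq_iff ..
  also have "\<dots> \<longleftrightarrow> (\<exists>S\<subseteq>labels d n.
      is_pure_stabilizer_state d n \<rho> (stab ` S) \<and> is_pure_stabilizer_state d n \<sigma> S)"
    using states by blast
  also have "\<dots> \<longleftrightarrow> (\<exists>S1 S2. is_pure_stabilizer_state d n \<rho> S1 \<and> is_pure_stabilizer_state d n \<sigma> S2
      \<and> S1 = stab ` S2)"
    by (auto simp: is_pure_stabilizer_state_def[of d n \<sigma>])
  finally show ?thesis .
qed

theorem mainTheorem14:
  fixes d n :: nat and g00 g01 g10 g11 :: int and \<rho> \<sigma> :: "complex mat"
  assumes "prime d" and "n \<ge> 1"
    and "\<not> int d dvd g00" and "\<not> int d dvd g01" and "\<not> int d dvd g10" and "\<not> int d dvd g11"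
    and "\<not> int d dvd (g00 * g11 - g01 * g10)"
    and "density_matrix (d ^ n) \<rho>" and "density_matrix (d ^ n) \<sigma>"
  shows "vN_entropy (qconv d n g00 g01 g10 g11 \<rho> \<sigma>) = 0 \<longleftrightarrow>
    (\<exists>S1 S2. is_pure_stabilizer_state d n \<rho> S1 \<and> is_pure_stabilizer_state d n \<sigma> S2
       \<and> S1 = stab_map d g00 g01 g10 g11 ` S2)"
proof -
  have "coprime u (int d)" if "\<not> int d dvd u" for u
    using prime_imp_coprime[of "int d" u] assms(1) that by (simp add: coprime_commute)
  then interpret qudit_convolution d n g00 g01 g10 g11
    using assms prime_gt_0_nat by unfold_locales auto
  show ?thesis
    using assms(8,9) by (rule vN_entropy_conv_eq_0_iff_stabilizer_states)
qed

end
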